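(* Let $\omega\in(0,1]$, let the randomized compression operator $Q$ satisfy $\mathbb{E}\lVert Q(\mathbf{x})-\mathbf{x}\rVert^2\le(1-\omega)\lVert\mathbf{x}\rVert^2$ for all $\mathbf{x}\in\mathbb{R}^d$, and let $\mathbf{W},\boldsymbol{\phi},\delta,C,\kappa,\beta$ be as in the context. Suppose that for all $i\in[n]$ and all $\mathbf{x},\mathbf{y}\in\mathbb{R}^d$: (1) (bounded variance) $\mathbb{E}_{\xi_i\sim\mathcal{D}_i}\lVert\nabla\tilde f_i(\mathbf{x},\xi_i)-\nabla f_i(\mathbf{x})\rVert^2\le\sigma^2$; (2) (bounded gradients) $\mathbb{E}_{\xi_i\sim\mathcal{D}_i}\lVert\nabla\tilde f_i(\mathbf{x},\xi_i)\rVert^2\le G^2$; (3) ($L$-smoothness, $L>0$) $\lVert\nabla f_i(\mathbf{x})-\nabla f_i(\mathbf{y})\rVert\le L\lVert\mathbf{x}-\mathbf{y}\rVert$; (4) (convexity) $f_i(\mathbf{x})+\langle\nabla f_i(\mathbf{x}),\mathbf{y}-\mathbf{x}\rangle\le f_i(\mathbf{y})$, and $\mathbf{x}^\star\in\arg\min_{\mathbf{x}\in\mathbb{R}^d}f(\mathbf{x})$. Let $T\ge n$ be an integer, $\eta:=\frac{\sqrt n}{4L\sqrt T}$, and $\gamma:=\frac{\omega\delta}{12\beta(\beta+1)(C+1)}$ (with $\gamma\in(0,1]$). Let $\mathbf{X}(t)$, with rows $\mathbf{x}_i(t)^\top$, be generated by the compressed push-sum stochastic gradient iteration given in the context with $\mathbf{X}(0)=\hat{\mathbf{X}}(0)=\mathbf{0}$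 and $\mathbf{y}(0)=\mathbf{1}$. Then $$\mathbb{E}f\Big(\frac{1}{nT}\sum_{t=0}^{T-1}\sum_{i=1}^n\mathbf{x}_i(t)\Big)-f(\mathbf{x}^\star)\le\frac{C_4}{\sqrt{nT}}+\frac{C_5}{T},$$ where $$C_4:=\frac{16L^2\lVert\mathbf{x}^\star\rVert^2+\sigma^2}{4L},\qquad C_5:=\frac{153\,C^2(C+1)^2\beta^2(\beta+1)^2G^2n}{L\omega^2\delta^4\kappa^2}.$$
   Context: Notation: $[n]=\{1,\dots,n\}$; $\mathbf{1}\in\mathbb{R}^n$ is the all-ones vector, $\mathbf{I}$ the $n\times n$ identity; $\lVert\cdot\rVert$ is the Euclidean norm of a vector and the induced (spectral) norm of a square matrix. Problem: for $i\in[n]$, $\tilde f_i:\mathbb{R}^d\times\mathcal{S}_i\to\mathbb{R}$ is agent $i$'s (differentiable in the first argument) loss, $\mathcal{D}_i$ a distribution on $\mathcal{S}_i$, $f_i(\mathbf{x})=\mathbb{E}_{\xi_i\sim\mathcal{D}_i}\tilde f_i(\mathbf{x},\xi_i)$, and $f=\frac1n\sum_{i=1}^nf_i$. Stochastic gradients are unbiased: $\nabla f_i(\mathbf{x})=\mathbb{E}_{\xi_i\sim\mathcal{D}_i}\nabla\tilde f_i(\mathbf{x},\xi_i)$. Network and mixing matrix: $\mathcal{G}=([n],\mathcal{E})$ is a fixed, strongly connected directed graph. $\mathbf{W}\in[0,1]^{n\times n}$ is column stochastic ($\mathbf{1}^\top\mathbf{W}=\mathbf{1}^\top$) and consistent with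 $\mathcal{G}$ in the sense that, for $i\ne j$, $\mathbf{W}_{ij}=0$ whenever $(j,i)\notin\mathcal{E}$ (every node is counted among its own neighbors). Set $\beta=\lVert\mathbf{W}-\mathbf{I}\rVert$. Fix constants $\delta\in(0,1]$, $C,\kappa>0$ and a stochastic vector $\boldsymbol{\phi}\in\mathbb{R}^n$ (nonnegative entries, $\mathbf{1}^\top\boldsymbol{\phi}=1$) such that for all $t\ge0$ and $i\in[n]$: $\mathbf{W}\boldsymbol{\phi}=\boldsymbol{\phi}$, $[\mathbf{W}^t\mathbf{1}]_i\ge\kappa$, and $\lVert\mathbf{W}^t-\boldsymbol{\phi}\mathbf{1}^\top\rVert\le C(1-\delta)^t$ (with $\mathbf{W}^0=\mathbf{I}$ and $0^0=1$). Compression: $Q$ is a randomized map $\mathbb{R}^d\to\mathbb{R}^d$; the expectation in its defining inequality is over its internal randomness. A fresh independent realization of the randomness is used each time an agent applies $Q$. On matrices $Q$ acts row by row. Iteration: with consensus stepsize $\gamma\in(0,1]$ and optimization stepsize $\eta>0$, matrices $\mathbf{X}(t),\hat{\mathbf{X}}(t),\mathbf{U}(t),\mathbf{Z}(t)\in\mathbb{R}^{n\times d}$ (with rows $\mathbf{x}_i(t)^\top,\hat{\mathbf{x}}_i(t)^\top,\mathbf{u}_i(t)^\top,\mathbf{z}_i(t)^\top$) and $\mathbf{y}(t)\in\mathbb{R}^n$ (entries $y_i(t)$) are generated for $t\ge0$ by $$\hat{\mathbf{X}}(t+1)=\hat{\mathbf{X}}(t)+Q(\mathbf{X}(t)-\hat{\mathbf{X}}(t)),\quad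 \mathbf{U}(t+1)=\mathbf{X}(t)+\gamma(\mathbf{W}-\mathbf{I})\hat{\mathbf{X}}(t+1),$$ $$\mathbf{y}(t+1)=\mathbf{W}\mathbf{y}(t),\quad \mathbf{z}_i(t+1)=\frac{\mathbf{u}_i(t+1)}{y_i(t+1)},\quad \mathbf{x}_i(t+1)=\mathbf{u}_i(t+1)-\eta\nabla\tilde f_i(\mathbf{z}_i(t+1),\xi_{i,t+1}),$$ where the samples $\xi_{i,t}\sim\mathcal{D}_i$ are independent across $i$ and $t$ and independent of the compression randomness. $\mathbb{E}$ in the conclusion is over all randomness. *)

theory Defs
  imports "HOL-Probability.Probability"
begin

definition gradient :: "('a::real_inner \<Rightarrow> real) \<Rightarrow> 'a \<Rightarrow> 'a" where
  "gradient h x = (THE g. GDERIV h x :> g)"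

definition spectral_norm :: "real^'n^'n \<Rightarrow> real" where
  "spectral_norm A = onorm (\<lambda>v. A *v v)"

(* The overloaded (^) acts entrywise on vectors, hence a separate matrix power. *)
primrec matrix_pow :: "real^'n^'n \<Rightarrow> nat \<Rightarrow> real^'n^'n" where
  "matrix_pow A 0 = mat 1"
| "matrix_pow A (Suc t) = A ** matrix_pow A t"

definition outer_prod :: "real^'n \<Rightarrow> real^'n \<Rightarrow> real^'n^'n" where
  "outer_prod u v = (\<chi> i j. u $ i * v $ j)"

definition strongly_connected :: "('n \<times> 'n) set \<Rightarrow> bool" where
  "strongly_connected E \<longleftrightarrow> (\<forall>i j. (i, j) \<in> E\<^sup>*)"

(* An edge (j, i) lets j send to i; self-loops are always allowed. *)
definition mixing_matrix :: "('n \<times> 'n) set \<Rightarrow> real^'n^'n \<Rightarrow> bool" where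
  "mixing_matrix E W \<longleftrightarrow>
     (\<forall>i j. 0 \<le> W $ i $ j \<and> W $ i $ j \<le> 1) \<and>
     vec 1 v* W = vec 1 \<and>
     (\<forall>i j. i \<noteq> j \<longrightarrow> (j, i) \<notin> E \<longrightarrow> W $ i $ j = 0)"

definition stochastic_vector :: "real^'n \<Rightarrow> bool" where
  "stochastic_vector \<phi> \<longleftrightarrow> (\<forall>i. 0 \<le> \<phi> $ i) \<and> (\<Sum>i\<in>UNIV. \<phi> $ i) = 1"

definition local_loss ::
    "('n \<Rightarrow> 's measure) \<Rightarrow> ('n \<Rightarrow> real^'d \<Rightarrow> 's \<Rightarrow> real) \<Rightarrow> 'n \<Rightarrow> real^'d \<Rightarrow> real" where
  "local_loss D ft i x = (\<integral>s. ft i x s \<partial>D i)"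

definition global_loss ::
    "('n::finite \<Rightarrow> 's measure) \<Rightarrow> ('n \<Rightarrow> real^'d \<Rightarrow> 's \<Rightarrow> real) \<Rightarrow> real^'d \<Rightarrow> real" where
  "global_loss D ft x = (1 / real CARD('n)) * (\<Sum>i\<in>UNIV. local_loss D ft i x)"

definition stoch_grad ::
    "('n \<Rightarrow> real^'d \<Rightarrow> 's \<Rightarrow> real) \<Rightarrow> 'n \<Rightarrow> real^'d \<Rightarrow> 's \<Rightarrow> real^'d" where
  "stoch_grad ft i x s = gradient (\<lambda>v. ft i v s) x"

(* The sample space of agent i is space (D i). The integrability of ft i x is what makes
   local_loss a genuine expectation, and that of the stochastic gradient likewise for its mean. *)
definition stochastic_problem ::
    "('n \<Rightarrow> 's measure) \<Rightarrow> ('n \<Rightarrow> real^'d \<Rightarrow> 's \<Rightarrow> real) \<Rightarrow> bool" where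
  "stochastic_problem D ft \<longleftrightarrow>
     (\<forall>i. prob_space (D i)) \<and>
     (\<forall>i x. \<forall>s\<in>space (D i). (\<lambda>v. ft i v s) differentiable (at x)) \<and>
     (\<forall>i x. integrable (D i) (ft i x)) \<and>
     (\<forall>i x. local_loss D ft i differentiable (at x)) \<and>
     (\<forall>i x. integrable (D i) (stoch_grad ft i x)) \<and>
     (\<forall>i x. gradient (local_loss D ft i) x = (\<integral>s. stoch_grad ft i x s \<partial>D i))"

(* A randomized map is a map Q x r of the input x and an internal random seed r with law R.
   Expectations of nonnegative quantities are taken in [0, \<infinity>]. *)
definition compression_operator ::
    "real \<Rightarrow> 'q measure \<Rightarrow> (real^'d \<Rightarrow> 'q \<Rightarrow> real^'d) \<Rightarrow> bool" where
  "compression_operator \<omega> R Q \<longleftrightarrow>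
     prob_space R \<and>
     (\<lambda>(x, r). Q x r) \<in> borel_measurable (borel \<Otimes>\<^sub>M R) \<and>
     (\<forall>x. (\<integral>\<^sup>+r. ennreal ((norm (Q x r - x))\<^sup>2) \<partial>R) \<le> ennreal ((1 - \<omega>) * (norm x)\<^sup>2))"

(* Joint independence of all samples \<xi> i t and all seeds \<rho> i t. The indep_vars of the library
   needs a common value type, so its definition is written out over the sum of the index sets. *)
definition algorithm_randomness ::
    "'w measure \<Rightarrow> ('n \<Rightarrow> 's measure) \<Rightarrow> 'q measure \<Rightarrow>
     ('n \<Rightarrow> nat \<Rightarrow> 'w \<Rightarrow> 's) \<Rightarrow> ('n \<Rightarrow> nat \<Rightarrow> 'w \<Rightarrow> 'q) \<Rightarrow> bool" where
  "algorithm_randomness M D R \<xi> \<rho> \<longleftrightarrow>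
     prob_space M \<and>
     (\<forall>i t. \<xi> i t \<in> measurable M (D i) \<and> distr M (D i) (\<xi> i t) = D i) \<and>
     (\<forall>i t. \<rho> i t \<in> measurable M R \<and> distr M R (\<rho> i t) = R) \<and>
     prob_space.indep_sets M
       (\<lambda>k. case k of
          Inl (i, t) \<Rightarrow> {\<xi> i t -` A \<inter> space M | A. A \<in> sets (D i)}
        | Inr (i, t) \<Rightarrow> {\<rho> i t -` A \<inter> space M | A. A \<in> sets R})
       (UNIV :: (('n \<times> nat) + ('n \<times> nat)) set)"

(* Row i of a matrix A :: real^'d^'n is A $ i. U and Z are constrained from index 1 on only. *)
definition compressed_push_sum_sgd ::
    "real^'n^'n \<Rightarrow> ('n \<Rightarrow> real^'d \<Rightarrow> 's \<Rightarrow> real) \<Rightarrow> (real^'d \<Rightarrow> 'q \<Rightarrow> real^'d) \<Rightarrow>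
     real \<Rightarrow> real \<Rightarrow> 'w measure \<Rightarrow>
     ('n \<Rightarrow> nat \<Rightarrow> 'w \<Rightarrow> 's) \<Rightarrow> ('n \<Rightarrow> nat \<Rightarrow> 'w \<Rightarrow> 'q) \<Rightarrow>
     (nat \<Rightarrow> 'w \<Rightarrow> real^'d^'n) \<Rightarrow> (nat \<Rightarrow> 'w \<Rightarrow> real^'d^'n) \<Rightarrow>
     (nat \<Rightarrow> 'w \<Rightarrow> real^'d^'n) \<Rightarrow> (nat \<Rightarrow> 'w \<Rightarrow> real^'d^'n) \<Rightarrow> (nat \<Rightarrow> real^'n) \<Rightarrow> bool" where
  "compressed_push_sum_sgd W ft Q \<gamma> \<eta> M \<xi> \<rho> X Xh U Z y \<longleftrightarrow>
     (\<forall>t. y (t + 1) = W *v y t) \<and>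
     (\<forall>w\<in>space M. \<forall>t.
        (\<forall>i. Xh (t + 1) w $ i = Xh t w $ i + Q (X t w $ i - Xh t w $ i) (\<rho> i t w)) \<and>
        U (t + 1) w = X t w + \<gamma> *\<^sub>R ((W - mat 1) ** Xh (t + 1) w) \<and>
        (\<forall>i. Z (t + 1) w $ i = U (t + 1) w $ i /\<^sub>R (y (t + 1) $ i)) \<and>
        (\<forall>i. X (t + 1) w $ i =
           U (t + 1) w $ i - \<eta> *\<^sub>R stoch_grad ft i (Z (t + 1) w $ i) (\<xi> i (t + 1) w)))"

end

theory Submission
  imports Defs
begin

text \<open>
  Because \<open>W\<close> is column stochastic, neither mixing nor compression changes the average \<open>xbar\<close> of the
  iterates. It therefore performs stochastic gradient descent, except that the gradient of agent \<open>i\<close>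
  is taken at the push-sum ratio \<open>z\<^sub>i\<close> instead of \<open>xbar\<close>. For smooth convex losses such a step still
  decreases the distance to the minimizer in proportion to the optimality gap, up to the squared
  deviations of the \<open>z\<^sub>i\<close> from \<open>xbar\<close> (\<open>perturbed_step\<close>). The gradient noises of different agents
  are uncorrelated with each other and with the past, so they only contribute \<open>\<eta>\<^sup>2 \<sigma>\<^sup>2 / n\<close>
  (\<open>distance_sq_Suc_le\<close>). Telescoping and Jensen's inequality give the rate once the deviations
  are known to be of order \<open>\<eta>\<close> in mean square.

  This is the content of \<open>push_sum_ratio_l2\<close>. There are two sources of deviation. First, the
  unnormalized iterates \<open>U\<close> differ from their consensus limit. Mixing with stepsize \<open>\<gamma>\<close> contracts
  at rate \<open>1 - \<gamma> \<delta>\<close> (\<open>damped_contraction\<close>), and is disturbed in every round by the gradient step and by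
  the compression error. The compression residual \<open>X - Xh\<close> is itself contracted by the compressor and
  fed by the gradient step and by the consensus error. The stepsize \<open>\<gamma>\<close> is so small that the gain of
  this feedback loop is below one, and both errors stay of the size of one gradient step
  (\<open>consensus_invariant\<close>). Second, the weights \<open>y\<close> approach \<open>n \<phi>\<close> only in the limit; their error
  decays geometrically, while \<open>xbar\<close> grows at most linearly in \<open>t\<close>.

  All error bounds are bounds of \<open>L\<^sup>2\<close> norms of random matrices, combined by Minkowski's inequality.
  Conditioning on the past is replaced by Fubini's theorem: the history and a fresh input have a
  product law (\<open>fresh_for_distr_pair\<close>). Since the gradients are evaluated at random points,
  this needs the stochastic gradient to be jointly measurable in the point and the sample
  (\<open>measurable_gradient_pair\<close>).
\<close>

section \<open>Frobenius norm and spectral norm\<close>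

lemma norm_matrix_sq_rows:
  fixes A :: "real^'d^'n"
  shows "(norm A)\<^sup>2 = (\<Sum>i\<in>UNIV. (norm (A $ i))\<^sup>2)"
  by (simp add: norm_vec_def L2_set_def sum_nonneg)

lemma norm_matrix_sq_columns:
  fixes A :: "real^'d^'n"
  shows "(norm A)\<^sup>2 = (\<Sum>j\<in>UNIV. (norm (column j A))\<^sup>2)"
proof -
  have *: "(norm (v::real^'k))\<^sup>2 = (\<Sum>i\<in>UNIV. (v $ i)\<^sup>2)" for v
    by (simp add: norm_vec_def L2_set_def sum_nonneg)
  have "(norm A)\<^sup>2 = (\<Sum>i\<in>UNIV. \<Sum>j\<in>UNIV. (A $ i $ j)\<^sup>2)"
    by (simp add: norm_matrix_sq_rows *)
  also have "\<dots> = (\<Sum>j\<in>UNIV. \<Sum>i\<in>UNIV. (A $ i $ j)\<^sup>2)" by (rule sum.swap)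
  finally show ?thesis by (simp add: * column_def)
qed

lemma spectral_norm_nonneg: "0 \<le> spectral_norm A"
  unfolding spectral_norm_def by (intro onorm_pos_le matrix_vector_mul_bounded_linear)

lemma norm_matrix_vector_le: "norm (A *v v) \<le> spectral_norm A * norm v"
  unfolding spectral_norm_def by (intro onorm matrix_vector_mul_bounded_linear)

lemma column_matrix_matrix_mult: "column j (A ** X) = A *v column j X"
  by (simp add: vec_eq_iff column_def matrix_matrix_mult_def matrix_vector_mult_def)

text \<open>\<^term>\<open>norm\<close> on matrices is the Frobenius norm, and left multiplication acts on the columns one by
  one; so the spectral norm bounds it without any factor depending on the dimensions.\<close>

lemma norm_matrix_mult_le:
  fixes X :: "real^'d^'n"
  shows "norm (A ** X) \<le> spectral_norm A * norm X"
proof (rule power2_le_imp_le)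
  have "(norm (A ** X))\<^sup>2 = (\<Sum>j\<in>UNIV. (norm (A *v column j X))\<^sup>2)"
    by (simp add: norm_matrix_sq_columns column_matrix_matrix_mult)
  also have "\<dots> \<le> (\<Sum>j\<in>UNIV. (spectral_norm A)\<^sup>2 * (norm (column j X))\<^sup>2)"
    by (intro sum_mono) (metis norm_matrix_vector_le power_mono norm_ge_zero power_mult_distrib)
  finally show "(norm (A ** X))\<^sup>2 \<le> (spectral_norm A * norm X)\<^sup>2"
    by (simp add: norm_matrix_sq_columns[of X] power_mult_distrib sum_distrib_left)
qed (simp add: spectral_norm_nonneg)

section \<open>Bounds in mean square\<close>

text \<open>A bound for the norm in \<open>L\<^sup>2(M)\<close>, kept as a predicate so that the estimates below compose
  through Minkowski's inequality without separate integrability conditions: the integral is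
  taken in the extended nonnegative reals and finiteness is part of the bound.\<close>

definition l2_bounded :: "'w measure \<Rightarrow> ('w \<Rightarrow> 'a::euclidean_space) \<Rightarrow> real \<Rightarrow> bool" where
  "l2_bounded M f a \<longleftrightarrow>
     f \<in> borel_measurable M \<and> 0 \<le> a \<and> (\<integral>\<^sup>+w. ennreal ((norm (f w))\<^sup>2) \<partial>M) \<le> ennreal (a\<^sup>2)"

lemma l2_boundedD:
  assumes "l2_bounded M f a"
  shows "f \<in> borel_measurable M" "0 \<le> a"
    "(\<integral>\<^sup>+w. ennreal ((norm (f w))\<^sup>2) \<partial>M) \<le> ennreal (a\<^sup>2)"
  using assms by (auto simp: l2_bounded_def)

lemma l2_bounded_dominated:
  assumes f: "l2_bounded M f a" and g: "g \<in> borel_measurable M" and c: "0 \<le> c"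
    and le: "\<And>w. w \<in> space M \<Longrightarrow> norm (g w) \<le> c * norm (f w)"
    and b: "c * a \<le> b"
  shows "l2_bounded M g b"
proof -
  note fa = l2_boundedD[OF f]
  have [measurable]: "f \<in> borel_measurable M" by (fact fa)
  have "(\<integral>\<^sup>+w. ennreal ((norm (g w))\<^sup>2) \<partial>M) \<le> (\<integral>\<^sup>+w. ennreal (c\<^sup>2) * ennreal ((norm (f w))\<^sup>2) \<partial>M)"
  proof (rule nn_integral_mono)
    fix w assume "w \<in> space M"
    from power_mono[OF le[OF this] norm_ge_zero, of 2]
    show "ennreal ((norm (g w))\<^sup>2) \<le> ennreal (c\<^sup>2) * ennreal ((norm (f w))\<^sup>2)"
      by (simp add: ennreal_mult'[symmetric] power_mult_distrib)
  qed
  also have "\<dots> = ennreal (c\<^sup>2) * (\<integral>\<^sup>+w. ennreal ((norm (f w))\<^sup>2) \<partial>M)"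
    by (rule nn_integral_cmult) simp
  also have "\<dots> \<le> ennreal (c\<^sup>2) * ennreal (a\<^sup>2)"
    by (intro mult_left_mono fa) simp
  also have "\<dots> = ennreal ((c * a)\<^sup>2)"
    by (simp add: ennreal_mult'[symmetric] power_mult_distrib)
  also have "\<dots> \<le> ennreal (b\<^sup>2)"
    using b c fa(2) by (intro ennreal_leI power_mono) auto
  finally show ?thesis
    using g order_trans[OF mult_nonneg_nonneg[OF c fa(2)] b] by (simp add: l2_bounded_def)
qed

lemma l2_bounded_weaken: "l2_bounded M f a \<Longrightarrow> a \<le> b \<Longrightarrow> l2_bounded M f b"
  by (rule l2_bounded_dominated[where c=1]) (auto dest: l2_boundedD)

lemma l2_bounded_cong:
  assumes "l2_bounded M f a" "\<And>w. w \<in> space M \<Longrightarrow> f w = g w"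
  shows "l2_bounded M g a"
proof (rule l2_bounded_dominated[OF assms(1), where c=1])
  show "g \<in> borel_measurable M"
    using l2_boundedD(1)[OF assms(1)] assms(2) by (simp cong: measurable_cong)
qed (use assms(2) in auto)

lemma l2_bounded_zero: "l2_bounded M (\<lambda>w. 0) 0"
  by (simp add: l2_bounded_def)

lemma l2_bounded_const:
  assumes "prob_space M" shows "l2_bounded M (\<lambda>w. v) (norm v)"
proof -
  interpret prob_space M by fact
  show ?thesis by (simp add: l2_bounded_def emeasure_space_1)
qed

lemma norm_add_sq_le:
  fixes u v :: "'a::real_inner"
  assumes "0 < a" "0 < b"
  shows "(norm (u + v))\<^sup>2 \<le> (a + b) / a * (norm u)\<^sup>2 + (a + b) / b * (norm v)\<^sup>2"
proof -
  have "(norm (u + v))\<^sup>2 \<le> (norm u + norm v)\<^sup>2"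
    by (intro power_mono norm_triangle_ineq) simp
  also have "\<dots> \<le> (a + b) / a * (norm u)\<^sup>2 + (a + b) / b * (norm v)\<^sup>2"
  proof -
    have "(a + b) / a * (norm u)\<^sup>2 + (a + b) / b * (norm v)\<^sup>2 - (norm u + norm v)\<^sup>2
      = (b * norm u - a * norm v)\<^sup>2 / (a * b)"
      using assms by (simp add: field_simps power2_eq_square)
    also have "\<dots> \<ge> 0" using assms by simp
    finally show ?thesis by simp
  qed
  finally show ?thesis .
qed

text \<open>Minkowski's inequality, by integrating \<open>norm_add_sq_le\<close>: its weights are the ones that make the
  two terms add up to the square of the sum of the bounds.\<close>

lemma l2_bounded_add_pos:
  assumes f: "l2_bounded M f a" and g: "l2_bounded M g b" and pos: "0 < a" "0 < b"
  shows "l2_bounded M (\<lambda>w. f w + g w) (a + b)"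
proof -
  note fa = l2_boundedD[OF f] and gb = l2_boundedD[OF g]
  have [measurable]: "f \<in> borel_measurable M" "g \<in> borel_measurable M" by (fact fa gb)+
  let ?p = "(a + b) / a" and ?q = "(a + b) / b"
  have "(\<integral>\<^sup>+w. ennreal ((norm (f w + g w))\<^sup>2) \<partial>M)
    \<le> (\<integral>\<^sup>+w. ennreal ?p * ennreal ((norm (f w))\<^sup>2) + ennreal ?q * ennreal ((norm (g w))\<^sup>2) \<partial>M)"
  proof (rule nn_integral_mono)
    fix w
    show "ennreal ((norm (f w + g w))\<^sup>2)
      \<le> ennreal ?p * ennreal ((norm (f w))\<^sup>2) + ennreal ?q * ennreal ((norm (g w))\<^sup>2)"
      using norm_add_sq_le[OF pos, of "f w" "g w"] pos
      by (simp add: ennreal_mult'[symmetric] ennreal_plus[symmetric] ennreal_leI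
          del: ennreal_plus)
  qed
  also have "\<dots> = ennreal ?p * (\<integral>\<^sup>+w. ennreal ((norm (f w))\<^sup>2) \<partial>M)
      + ennreal ?q * (\<integral>\<^sup>+w. ennreal ((norm (g w))\<^sup>2) \<partial>M)"
    by (simp add: nn_integral_add nn_integral_cmult)
  also have "\<dots> \<le> ennreal ?p * ennreal (a\<^sup>2) + ennreal ?q * ennreal (b\<^sup>2)"
    by (intro add_mono mult_left_mono fa gb) auto
  also have "\<dots> = ennreal (?p * a\<^sup>2 + ?q * b\<^sup>2)"
    using pos by (simp add: ennreal_mult'[symmetric] ennreal_plus[symmetric] del: ennreal_plus)
  also have "?p * a\<^sup>2 + ?q * b\<^sup>2 = (a + b)\<^sup>2"
    using pos by (simp add: field_simps power2_eq_square)
  finally show ?thesis using pos by (simp add: l2_bounded_def)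
qed

text \<open>The weights above degenerate for a zero bound; that case is reached by enlarging both bounds
  by \<open>e\<close> and letting \<open>e\<close> tend to zero.\<close>

lemma l2_bounded_add:
  assumes f: "l2_bounded M f a" and g: "l2_bounded M g b"
  shows "l2_bounded M (\<lambda>w. f w + g w) (a + b)"
proof -
  note fa = l2_boundedD[OF f] and gb = l2_boundedD[OF g]
  have [measurable]: "f \<in> borel_measurable M" "g \<in> borel_measurable M" by (fact fa gb)+
  have "(\<integral>\<^sup>+w. ennreal ((norm (f w + g w))\<^sup>2) \<partial>M) \<le> ennreal ((a + b + 2 * e)\<^sup>2)" if "0 < e" for e
  proof -
    have "l2_bounded M (\<lambda>w. f w + g w) ((a + e) + (b + e))"
      using fa(2) gb(2) that
      by (intro l2_bounded_add_pos l2_bounded_weaken[OF f] l2_bounded_weaken[OF g]) auto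
    then show ?thesis by (auto dest!: l2_boundedD(3) simp: algebra_simps)
  qed
  moreover have "((\<lambda>e. ennreal ((a + b + 2 * e)\<^sup>2)) \<longlongrightarrow> ennreal ((a + b + 2 * 0)\<^sup>2)) (at_right 0)"
    by (intro tendsto_intros)
  moreover have "\<forall>\<^sub>F e in at_right (0::real). (\<integral>\<^sup>+w. ennreal ((norm (f w + g w))\<^sup>2) \<partial>M)
      \<le> ennreal ((a + b + 2 * e)\<^sup>2)"
    using eventually_at_right_less by (rule eventually_mono) fact
  ultimately have "(\<integral>\<^sup>+w. ennreal ((norm (f w + g w))\<^sup>2) \<partial>M) \<le> ennreal ((a + b + 2 * 0)\<^sup>2)"
    by (intro tendsto_lowerbound) auto
  with fa(2) gb(2) show ?thesis by (simp add: l2_bounded_def)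
qed

lemma l2_bounded_linear_image:
  assumes "l2_bounded M f a" and "bounded_linear h" and "\<And>v. norm (h v) \<le> c * norm v"
    and "0 \<le> c" "c * a \<le> b"
  shows "l2_bounded M (\<lambda>w. h (f w)) b"
proof (rule l2_bounded_dominated[OF assms(1) _ \<open>0 \<le> c\<close> _ \<open>c * a \<le> b\<close>])
  have "h \<in> borel_measurable borel"
    by (intro borel_measurable_continuous_onI linear_continuous_on assms)
  then show "(\<lambda>w. h (f w)) \<in> borel_measurable M"
    using l2_boundedD(1)[OF assms(1)] by measurable
qed (use assms in auto)

lemma l2_bounded_scaleR:
  assumes "l2_bounded M f a" shows "l2_bounded M (\<lambda>w. c *\<^sub>R f w) (\<bar>c\<bar> * a)"
  by (rule l2_bounded_linear_image[OF assms bounded_linear_scaleR_right]) auto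

lemma l2_bounded_diff:
  assumes f: "l2_bounded M f a" and g: "l2_bounded M g b"
  shows "l2_bounded M (\<lambda>w. f w - g w) (a + b)"
  using l2_bounded_add[OF f l2_bounded_scaleR[OF g, of "-1"]] by simp

lemma l2_bounded_sum:
  assumes "finite S" "\<And>i. i \<in> S \<Longrightarrow> l2_bounded M (f i) (a i)"
  shows "l2_bounded M (\<lambda>w. \<Sum>i\<in>S. f i w) (\<Sum>i\<in>S. a i)"
  using assms by (induction S) (auto intro: l2_bounded_add l2_bounded_zero)

lemma l2_bounded_matrix_mult:
  fixes f :: "'w \<Rightarrow> real^'d^'n"
  assumes "l2_bounded M f a" "\<And>v. norm (A ** v :: real^'d^'n) \<le> c * norm v" "0 \<le> c" "c * a \<le> b"
  shows "l2_bounded M (\<lambda>w. A ** f w) b"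
proof (rule l2_bounded_linear_image[OF assms(1) _ assms(2-4)])
  show "bounded_linear ((**) A :: real^'d^'n \<Rightarrow> _)"
    by (rule linear_conv_bounded_linear[THEN iffD1])
       (auto intro!: linearI simp: matrix_add_ldistrib vec_eq_iff matrix_matrix_mult_def
         sum_distrib_left sum.distrib algebra_simps)
qed

lemma borel_measurable_row:
  fixes f :: "'w \<Rightarrow> 'a::euclidean_space^'n"
  assumes "f \<in> borel_measurable M"
  shows "(\<lambda>w. f w $ i) \<in> borel_measurable M"
  by (rule measurable_compose[OF assms]) (intro borel_measurable_continuous_onI continuous_intros)

lemma borel_measurable_rows:
  fixes f :: "'w \<Rightarrow> 'a::euclidean_space^'n"
  assumes "\<And>i. (\<lambda>w. f w $ i) \<in> borel_measurable M"
  shows "f \<in> borel_measurable M"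
proof (subst borel_measurable_euclidean_space, rule ballI)
  fix b :: "'a^'n" assume "b \<in> Basis"
  then obtain i u where "b = axis i u" by (auto simp: Basis_vec_def)
  then show "(\<lambda>w. f w \<bullet> b) \<in> borel_measurable M"
    using assms[of i] by (simp add: inner_axis)
qed

lemma nn_integral_norm_sq_rows:
  fixes f :: "'w \<Rightarrow> real^'d^'n"
  assumes "f \<in> borel_measurable M"
  shows "(\<integral>\<^sup>+w. ennreal ((norm (f w))\<^sup>2) \<partial>M) = (\<Sum>i\<in>UNIV. \<integral>\<^sup>+w. ennreal ((norm (f w $ i))\<^sup>2) \<partial>M)"
proof -
  have [measurable]: "(\<lambda>w. f w $ i) \<in> borel_measurable M" for i
    by (rule borel_measurable_row) fact
  have "(\<integral>\<^sup>+w. ennreal ((norm (f w))\<^sup>2) \<partial>M) = (\<integral>\<^sup>+w. (\<Sum>i\<in>UNIV. ennreal ((norm (f w $ i))\<^sup>2)) \<partial>M)"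
    by (simp add: norm_matrix_sq_rows sum_ennreal)
  also have "\<dots> = (\<Sum>i\<in>UNIV. \<integral>\<^sup>+w. ennreal ((norm (f w $ i))\<^sup>2) \<partial>M)"
    by (intro nn_integral_sum) measurable
  finally show ?thesis .
qed

lemma l2_bounded_rows:
  fixes f :: "'w \<Rightarrow> real^'d^'n"
  assumes f: "f \<in> borel_measurable M"
    and le: "\<And>i. (\<integral>\<^sup>+w. ennreal ((norm (f w $ i))\<^sup>2) \<partial>M) \<le> c i"
    and tot: "(\<Sum>i\<in>UNIV. c i) \<le> ennreal (a\<^sup>2)" "0 \<le> a"
  shows "l2_bounded M f a"
  using f tot order_trans[OF sum_mono[of UNIV, OF le] tot(1)]
  by (simp add: l2_bounded_def nn_integral_norm_sq_rows[OF f])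

lemma l2_bounded_integrable_norm_sq:
  assumes "l2_bounded M f a"
  shows "integrable M (\<lambda>w. (norm (f w))\<^sup>2)"
proof (rule integrableI_bounded)
  have [measurable]: "f \<in> borel_measurable M" by (rule l2_boundedD[OF assms])
  show "(\<lambda>w. (norm (f w))\<^sup>2) \<in> borel_measurable M" by measurable
  show "(\<integral>\<^sup>+w. ennreal (norm ((norm (f w))\<^sup>2)) \<partial>M) < \<infinity>"
    using l2_boundedD(3)[OF assms] by (simp add: order_le_less_trans[OF _ ennreal_less_top])
qed

lemma l2_bounded_integral_norm_sq:
  assumes "l2_bounded M f a"
  shows "(\<integral>w. (norm (f w))\<^sup>2 \<partial>M) \<le> a\<^sup>2"
proof -
  have "ennreal (\<integral>w. (norm (f w))\<^sup>2 \<partial>M) = (\<integral>\<^sup>+w. ennreal ((norm (f w))\<^sup>2) \<partial>M)"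
    by (intro nn_integral_eq_integral[symmetric] l2_bounded_integrable_norm_sq[OF assms]) simp
  also have "\<dots> \<le> ennreal (a\<^sup>2)" by (rule l2_boundedD[OF assms])
  finally show ?thesis by simp
qed

lemma l2_bounded_integrable_inner:
  fixes f g :: "'w \<Rightarrow> 'a::euclidean_space"
  assumes f: "l2_bounded M f a" and g: "l2_bounded M g b"
  shows "integrable M (\<lambda>w. f w \<bullet> g w)"
proof (rule Bochner_Integration.integrable_bound)
  have [measurable]: "f \<in> borel_measurable M" "g \<in> borel_measurable M"
    using f g by (auto dest: l2_boundedD)
  show "integrable M (\<lambda>w. (norm (f w))\<^sup>2 + (norm (g w))\<^sup>2)"
    by (intro Bochner_Integration.integrable_add l2_bounded_integrable_norm_sq[OF f] l2_bounded_integrable_norm_sq[OF g])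
  show "(\<lambda>w. f w \<bullet> g w) \<in> borel_measurable M" by measurable
  have "\<bar>u \<bullet> v\<bar> \<le> (norm u)\<^sup>2 + (norm v)\<^sup>2" for u v :: 'a
  proof -
    have "\<bar>u \<bullet> v\<bar> \<le> norm u * norm v" by (rule Cauchy_Schwarz_ineq2)
    also have "\<dots> \<le> (norm u)\<^sup>2 + (norm v)\<^sup>2"
      using sum_squares_bound[of "norm u" "norm v"]
        mult_nonneg_nonneg[of "norm u" "norm v"] by (simp del: mult_nonneg_nonneg)
    finally show ?thesis .
  qed
  then show "AE w in M. norm (f w \<bullet> g w) \<le> norm ((norm (f w))\<^sup>2 + (norm (g w))\<^sup>2)" by simp
qed

section \<open>Freezing the past\<close>

text \<open>\<open>\<zeta>\<close> has law \<open>N\<close> and is independent of the \<open>\<sigma>\<close>-algebra of \<open>F\<close>. Presenting the past as a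
  \<open>\<sigma>\<close>-algebra rather than as a random variable lets a whole history of random variables of
  different types be frozen at once.\<close>

definition fresh_for :: "'w measure \<Rightarrow> 'w measure \<Rightarrow> 's measure \<Rightarrow> ('w \<Rightarrow> 's) \<Rightarrow> bool" where
  "fresh_for M F N \<zeta> \<longleftrightarrow> prob_space M \<and> space F = space M \<and> sets F \<subseteq> sets M \<and> \<zeta> \<in> measurable M N \<and>
     distr M N \<zeta> = N \<and>
     (\<forall>A\<in>sets F. \<forall>B\<in>sets N.
        measure M (A \<inter> (\<zeta> -` B \<inter> space M)) = measure M A * measure M (\<zeta> -` B \<inter> space M))"

text \<open>The pair (outcome seen through the past, fresh variable) has a product law. Everything that
  conditioning on the past would give then follows from Fubini's theorem.\<close>

lemma fresh_for_distr_pair: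
  assumes "fresh_for M F N \<zeta>"
  shows "distr M F (\<lambda>w. w) \<Otimes>\<^sub>M N = distr M (F \<Otimes>\<^sub>M N) (\<lambda>w. (w, \<zeta> w))"
proof -
  interpret M: prob_space M using assms by (simp add: fresh_for_def)
  have id: "(\<lambda>w. w) \<in> measurable M F" and z[measurable]: "\<zeta> \<in> measurable M N"
    and dz: "distr M N \<zeta> = N"
    using assms by (auto simp: fresh_for_def measurable_def dest: sets.sets_into_space)
  interpret F: prob_space "distr M F (\<lambda>w. w)" by (rule M.prob_space_distr) fact
  have "prob_space (distr M N \<zeta>)" by (rule M.prob_space_distr) fact
  then interpret N: prob_space N by (simp add: dz)
  show ?thesis
  proof (rule pair_measure_eqI)
    fix A B assume "A \<in> sets (distr M F (\<lambda>w. w))" and B: "B \<in> sets N"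
    then have A: "A \<in> sets F" by simp
    then have A': "A \<in> sets M" "A \<inter> space M = A"
      using assms sets.sets_into_space[of A F] by (auto simp: fresh_for_def)
    have "emeasure N B = emeasure M (\<zeta> -` B \<inter> space M)"
      using emeasure_distr[OF z B] dz by simp
    then have "emeasure (distr M F (\<lambda>w. w)) A * emeasure N B
      = ennreal (measure M A * measure M (\<zeta> -` B \<inter> space M))"
      using A A' by (simp add: emeasure_distr[OF id] M.emeasure_eq_measure ennreal_mult)
    also have "\<dots> = emeasure M (A \<inter> (\<zeta> -` B \<inter> space M))"
      using assms A B by (simp add: fresh_for_def M.emeasure_eq_measure)
    also have "A \<inter> (\<zeta> -` B \<inter> space M) = (\<lambda>w. (w, \<zeta> w)) -` (A \<times> B) \<inter> space M"
      by auto
    finally show "emeasure (distr M F (\<lambda>w. w)) A * emeasure N B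
        = emeasure (distr M (F \<Otimes>\<^sub>M N) (\<lambda>w. (w, \<zeta> w))) (A \<times> B)"
      using A B by (simp add: emeasure_distr[OF measurable_Pair[OF id z]])
  qed (simp_all add: F.sigma_finite_measure_axioms N.sigma_finite_measure_axioms cong: sets_pair_measure_cong)
qed

text \<open>An expectation involving the past and a fresh variable may be computed by first averaging over
  the fresh variable with the past held fixed. This transfers the moment bounds of the
  compressor and of the stochastic gradients, given for deterministic arguments, to random ones.\<close>

lemma nn_integral_freeze:
  assumes fr: "fresh_for M F N \<zeta>"
    and \<phi>[measurable]: "\<phi> \<in> borel_measurable (F \<Otimes>\<^sub>M N)"
  shows "(\<integral>\<^sup>+w. \<phi> (w, \<zeta> w) \<partial>M) = (\<integral>\<^sup>+w. (\<integral>\<^sup>+s. \<phi> (w, s) \<partial>N) \<partial>M)"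
proof -
  interpret M: prob_space M using fr by (simp add: fresh_for_def)
  have id: "(\<lambda>w. w) \<in> measurable M F" and z[measurable]: "\<zeta> \<in> measurable M N"
    and dz: "distr M N \<zeta> = N"
    using fr by (auto simp: fresh_for_def measurable_def dest: sets.sets_into_space)
  have "prob_space (distr M N \<zeta>)" by (rule M.prob_space_distr) fact
  then interpret N: prob_space N by (simp add: dz)
  have "(\<integral>\<^sup>+w. \<phi> (w, \<zeta> w) \<partial>M) = (\<integral>\<^sup>+p. \<phi> p \<partial>distr M (F \<Otimes>\<^sub>M N) (\<lambda>w. (w, \<zeta> w)))"
    by (subst nn_integral_distr[OF measurable_Pair[OF id z]]) auto
  also have "\<dots> = (\<integral>\<^sup>+p. \<phi> p \<partial>(distr M F (\<lambda>w. w) \<Otimes>\<^sub>M N))"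
    by (simp add: fresh_for_distr_pair[OF fr])
  also have "\<dots> = (\<integral>\<^sup>+w. (\<integral>\<^sup>+s. \<phi> (w, s) \<partial>N) \<partial>distr M F (\<lambda>w. w))"
    by (rule N.nn_integral_fst[symmetric]) (simp cong: measurable_cong_sets sets_pair_measure_cong)
  also have "\<dots> = (\<integral>\<^sup>+w. (\<integral>\<^sup>+s. \<phi> (w, s) \<partial>N) \<partial>M)"
    by (subst nn_integral_distr[OF id]) (auto intro: N.borel_measurable_nn_integral_fst)
  finally show ?thesis .
qed

text \<open>The signed counterpart, for quantities whose average over the fresh variable vanishes.\<close>

lemma integral_freeze_eq_zero:
  fixes \<phi> :: "'w \<times> 's \<Rightarrow> real"
  assumes fr: "fresh_for M F N \<zeta>"
    and \<phi>[measurable]: "\<phi> \<in> borel_measurable (F \<Otimes>\<^sub>M N)"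
    and int: "integrable M (\<lambda>w. \<phi> (w, \<zeta> w))"
    and zero: "\<And>w. w \<in> space M \<Longrightarrow> (\<integral>s. \<phi> (w, s) \<partial>N) = 0"
  shows "(\<integral>w. \<phi> (w, \<zeta> w) \<partial>M) = 0"
proof -
  interpret M: prob_space M using fr by (simp add: fresh_for_def)
  have id: "(\<lambda>w. w) \<in> measurable M F" and z[measurable]: "\<zeta> \<in> measurable M N"
    and dz: "distr M N \<zeta> = N" and sp: "space F = space M"
    using fr by (auto simp: fresh_for_def measurable_def dest: sets.sets_into_space)
  interpret F: prob_space "distr M F (\<lambda>w. w)" by (rule M.prob_space_distr) fact
  have "prob_space (distr M N \<zeta>)" by (rule M.prob_space_distr) fact
  then interpret N: prob_space N by (simp add: dz)
  interpret P: pair_sigma_finite "distr M F (\<lambda>w. w)" N ..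
  have pair: "(\<lambda>w. (w, \<zeta> w)) \<in> M \<rightarrow>\<^sub>M F \<Otimes>\<^sub>M N" by (rule measurable_Pair[OF id z])
  have "integrable (distr M F (\<lambda>w. w) \<Otimes>\<^sub>M N) \<phi>"
    unfolding fresh_for_distr_pair[OF fr]
    using int by (subst integrable_distr_eq[OF pair \<phi>])
  from P.integral_fst'[OF this]
  have "(\<integral>p. \<phi> p \<partial>(distr M F (\<lambda>w. w) \<Otimes>\<^sub>M N))
    = (\<integral>w. (\<integral>s. \<phi> (w, s) \<partial>N) \<partial>distr M F (\<lambda>w. w))" by simp
  also have "\<dots> = 0"
    using zero sp by (subst Bochner_Integration.integral_cong[where g="\<lambda>_. 0"]) auto
  finally show ?thesis
    unfolding fresh_for_distr_pair[OF fr] by (simp add: integral_distr[OF pair \<phi>])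
qed

definition generated_algebra :: "'w measure \<Rightarrow> ('k \<Rightarrow> 'w set set) \<Rightarrow> 'k set \<Rightarrow> 'w measure" where
  "generated_algebra M \<A> K = sigma (space M) (\<Union>k\<in>K. \<A> k)"

lemma generated_algebra_mono:
  assumes "\<And>k. \<A> k \<subseteq> Pow (space M)" "K \<subseteq> K'" "f \<in> measurable (generated_algebra M \<A> K) N"
  shows "f \<in> measurable (generated_algebra M \<A> K') N"
proof (rule measurable_from_subalg[OF _ assms(3)])
  have *: "(\<Union>k\<in>J. \<A> k) \<subseteq> Pow (space M)" for J using assms(1) by blast
  have "sigma_sets (space M) (\<Union>k\<in>K. \<A> k) \<subseteq> sigma_sets (space M) (\<Union>k\<in>K'. \<A> k)"
    using assms(2) by (intro sigma_sets_mono') blast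
  then show "subalgebra (generated_algebra M \<A> K') (generated_algebra M \<A> K)"
    using * by (simp add: subalgebra_def generated_algebra_def space_measure_of sets_measure_of)
qed

lemma measurable_generated_algebra:
  assumes "\<And>k. \<A> k \<subseteq> Pow (space M)" "k \<in> K" and f: "f \<in> measurable M N"
    and "\<And>B. B \<in> sets N \<Longrightarrow> f -` B \<inter> space M \<in> \<A> k"
  shows "f \<in> measurable (generated_algebra M \<A> K) N"
proof (rule measurableI)
  have *: "(\<Union>k\<in>K. \<A> k) \<subseteq> Pow (space M)" using assms(1) by blast
  then have sp: "space (generated_algebra M \<A> K) = space M"
    by (simp add: generated_algebra_def space_measure_of)
  fix B assume "B \<in> sets N"
  then show "f -` B \<inter> space (generated_algebra M \<A> K) \<in> sets (generated_algebra M \<A> K)"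
    unfolding sp using assms(2,4) *
    by (auto simp: generated_algebra_def sets_measure_of intro!: sigma_sets.Basic)
next
  fix x assume "x \<in> space (generated_algebra M \<A> K)"
  moreover have "(\<Union>k\<in>K. \<A> k) \<subseteq> Pow (space M)" using assms(1) by blast
  ultimately show "f x \<in> space N"
    using measurable_space[OF f] by (simp add: generated_algebra_def space_measure_of)
qed

text \<open>Grouping of independent families: what is generated by the families in \<open>K\<close> is independent of any
  variable generating a family outside \<open>K\<close>.\<close>

lemma fresh_for_generated_algebra:
  assumes M: "prob_space M" and ind: "prob_space.indep_sets M \<A> UNIV"
    and stable: "\<And>k. Int_stable (\<A> k)" and "k \<notin> K"
    and z: "\<zeta> \<in> measurable M N" and dz: "distr M N \<zeta> = N"
    and \<A>: "\<And>B. B \<in> sets N \<Longrightarrow> \<zeta> -` B \<inter> space M \<in> \<A> k"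
  shows "fresh_for M (generated_algebra M \<A> K) N \<zeta>"
proof -
  interpret prob_space M by fact
  have ev: "\<A> j \<subseteq> events" for j using ind by (auto simp: indep_sets_def)
  then have pow: "(\<Union>j\<in>J. \<A> j) \<subseteq> Pow (space M)" for J
    using sets.sets_into_space by blast
  have sp: "space (generated_algebra M \<A> K) = space M"
    and st: "sets (generated_algebra M \<A> K) = sigma_sets (space M) (\<Union>j\<in>K. \<A> j)"
    using pow[of K] by (simp_all add: generated_algebra_def space_measure_of sets_measure_of)
  have sub: "sets (generated_algebra M \<A> K) \<subseteq> events"
    unfolding st using ev by (intro sets.sigma_sets_subset) auto
  have "indep_sets (\<lambda>b. sigma_sets (space M) (\<Union>j\<in>(if b then K else {k}). \<A> j)) UNIV"
  proof (rule indep_sets_collect_sigma)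
    \<comment> \<open>The grouping has two blocks, indexed by \<^typ>\<open>bool\<close>: \<open>K\<close> and the single index \<open>k\<close>.\<close>
    show "indep_sets \<A> (\<Union>b\<in>UNIV. if b then K else {k})"
      by (rule indep_sets_mono_index[OF _ ind]) auto
    show "disjoint_family_on (\<lambda>b. if b then K else {k}) UNIV"
      using \<open>k \<notin> K\<close> by (auto simp: disjoint_family_on_def)
  qed (rule stable)
  then have ind2: "indep_set (sigma_sets (space M) (\<Union>j\<in>K. \<A> j)) (sigma_sets (space M) (\<A> k))"
    unfolding indep_set_def
    by (rule indep_sets_cong[THEN iffD1, rotated -1]) (auto split: bool.split)
  have "prob (A \<inter> (\<zeta> -` B \<inter> space M)) = prob A * prob (\<zeta> -` B \<inter> space M)"
    if "A \<in> sets (generated_algebra M \<A> K)" "B \<in> sets N" for A B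
    using that by (intro indep_setD[OF ind2]) (auto simp: st \<A>)
  then show ?thesis using M sp sub z dz by (auto simp: fresh_for_def)
qed

section \<open>Measurability of the stochastic gradient\<close>

text \<open>A function continuous in its first and measurable in its second argument (a Caratheodory function)
  is jointly measurable: replace the first argument by finitely-valued approximations and pass to
  the limit.\<close>

lemma measurable_continuous_pair:
  fixes h :: "'a::euclidean_space \<Rightarrow> 's \<Rightarrow> real"
  assumes cont: "\<And>s. s \<in> space N \<Longrightarrow> continuous_on UNIV (\<lambda>x. h x s)"
    and meas: "\<And>x. h x \<in> borel_measurable N"
  shows "(\<lambda>(x, s). h x s) \<in> borel_measurable (borel \<Otimes>\<^sub>M N)"
proof -
  have "(\<lambda>x::'a. x) \<in> borel_measurable borel" by simp
  from borel_measurable_implies_sequence_metric[OF this, of 0] obtain r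
    where simple: "\<And>k. simple_function (borel :: 'a measure) (r k)"
      and lim: "\<And>x::'a. (\<lambda>k. r k x) \<longlonglongrightarrow> x" by auto
  show ?thesis
  proof (rule borel_measurable_LIMSEQ_real)
    fix p :: "'a \<times> 's" assume p: "p \<in> space (borel \<Otimes>\<^sub>M N)"
    obtain x s where ps: "p = (x, s)" by fastforce
    with p have "continuous_on UNIV (\<lambda>x. h x s)" by (intro cont) (auto simp: space_pair_measure)
    then have "(\<lambda>k. h (r k x) s) \<longlonglongrightarrow> h x s"
      by (rule continuous_on_tendsto_compose[OF _ lim]) auto
    then show "(\<lambda>k. (\<lambda>(x, s). h (r k x) s) p) \<longlonglongrightarrow> (\<lambda>(x, s). h x s) p" by (simp add: ps)
  next
    fix k
    have fin: "finite (range (r k))" using simple_functionD(1)[OF simple] by simp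
    have r: "r k \<in> measurable borel (count_space (range (r k)))"
      using simple[of k] by (simp add: simple_function_def measurable_count_space_eq2 fin)
    have "(\<lambda>p. h (r k (fst p)) (snd p)) \<in> borel_measurable (borel \<Otimes>\<^sub>M N)"
    proof (rule measurable_compose_countable'[where I="range (r k)" and g="\<lambda>p. r k (fst p)"
          and f="\<lambda>v p. h v (snd p)"])
      show "(\<lambda>p. h v (snd p)) \<in> borel_measurable (borel \<Otimes>\<^sub>M N)" for v
        using meas[of v] by measurable
      show "(\<lambda>p. r k (fst p)) \<in> borel \<Otimes>\<^sub>M N \<rightarrow>\<^sub>M count_space (range (r k))"
        by (rule measurable_compose[OF measurable_fst r])
    qed (use fin in \<open>simp add: countable_finite\<close>)
    then show "(\<lambda>(x, s). h (r k x) s) \<in> borel_measurable (borel \<Otimes>\<^sub>M N)"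
      by (simp add: case_prod_beta')
  qed
qed

lemma GDERIV_gradient:
  fixes h :: "'a::euclidean_space \<Rightarrow> real"
  assumes "h differentiable (at x)"
  shows "GDERIV h x :> gradient h x"
proof -
  from assms obtain H where H: "(h has_derivative H) (at x)" by (auto simp: differentiable_def)
  then interpret H: bounded_linear H by (rule has_derivative_bounded_linear)
  define g0 where "g0 = (\<Sum>b\<in>Basis. H b *\<^sub>R b)"
  have Hv: "H v = v \<bullet> g0" for v
  proof -
    have "H v = H (\<Sum>b\<in>Basis. (v \<bullet> b) *\<^sub>R b)" by (simp add: euclidean_representation)
    then show ?thesis by (simp add: g0_def H.sum H.scaleR inner_sum_right mult.commute)
  qed
  have H_eq: "H = (\<lambda>v. v \<bullet> g0)" by (rule ext) (rule Hv)
  have unique: "g = g0" if "GDERIV h x :> g" for g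
  proof -
    have "(h has_derivative (\<lambda>v. v \<bullet> g)) (at x)" using that by (simp only: gderiv_def)
    from has_derivative_unique[OF this H] have "v \<bullet> g = v \<bullet> g0" for v
      unfolding H_eq by (rule fun_cong)
    then show ?thesis by (metis euclidean_eqI inner_commute)
  qed
  have deriv: "GDERIV h x :> g0" using H unfolding gderiv_def H_eq .
  have "gradient h x = g0"
    unfolding gradient_def by (rule the_equality) (rule deriv, erule unique)
  with deriv show ?thesis by (simp only:)
qed

lemma GDERIV_along_line:
  fixes h :: "'a::real_inner \<Rightarrow> real"
  assumes "GDERIV h (u + s *\<^sub>R v) :> g"
  shows "((\<lambda>s. h (u + s *\<^sub>R v)) has_real_derivative (v \<bullet> g)) (at s)"
proof -
  have "((\<lambda>s. h (u + s *\<^sub>R v)) has_derivative (\<lambda>r. (r *\<^sub>R v) \<bullet> g)) (at s)"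
    using assms unfolding gderiv_def
    by (rule has_derivative_compose[rotated]) (auto intro!: derivative_eq_intros)
  then show ?thesis by (rule has_derivative_imp_has_field_derivative) simp
qed

text \<open>The stochastic gradient is evaluated at random points, so measurability in the sample alone does
  not suffice. Each partial derivative is a pointwise limit of difference quotients, and these are
  jointly measurable by \<open>measurable_continuous_pair\<close>.\<close>

lemma measurable_gradient_pair:
  fixes h :: "'a::euclidean_space \<Rightarrow> 's \<Rightarrow> real"
  assumes diff: "\<And>x s. s \<in> space N \<Longrightarrow> (\<lambda>v. h v s) differentiable (at x)"
    and meas: "\<And>x. h x \<in> borel_measurable N"
  shows "(\<lambda>(x, s). gradient (\<lambda>v. h v s) x) \<in> borel_measurable (borel \<Otimes>\<^sub>M N)"
proof (subst borel_measurable_euclidean_space, rule ballI)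
  fix b :: 'a assume "b \<in> Basis"
  have h[measurable]: "(\<lambda>(x, s). h x s) \<in> borel_measurable (borel \<Otimes>\<^sub>M N)"
    using diff by (intro measurable_continuous_pair meas)
      (auto intro!: differentiable_imp_continuous_on simp: differentiable_on_def differentiable_at_withinI)
  show "(\<lambda>p. (case p of (x, s) \<Rightarrow> gradient (\<lambda>v. h v s) x) \<bullet> b) \<in> borel_measurable (borel \<Otimes>\<^sub>M N)"
  proof (rule borel_measurable_LIMSEQ_real)
    fix p :: "'a \<times> 's" assume p: "p \<in> space (borel \<Otimes>\<^sub>M N)"
    obtain x s where ps: "p = (x, s)" by fastforce
    with p have "s \<in> space N" by (auto simp: space_pair_measure)
    then have "((\<lambda>r. h (x + r *\<^sub>R b) s) has_real_derivative (b \<bullet> gradient (\<lambda>v. h v s) x)) (at 0)"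
      by (intro GDERIV_along_line) (simp add: GDERIV_gradient diff)
    then have "((\<lambda>r. (h (x + r *\<^sub>R b) s - h x s) / r) \<longlongrightarrow> b \<bullet> gradient (\<lambda>v. h v s) x) (at 0)"
      by (simp add: DERIV_def)
    moreover have "filterlim (\<lambda>k. inverse (real (Suc k))) (at 0) sequentially"
      by (simp add: filterlim_at LIMSEQ_inverse_real_of_nat del: of_nat_Suc)
    ultimately have "(\<lambda>k. (h (x + inverse (real (Suc k)) *\<^sub>R b) s - h x s) / inverse (real (Suc k)))
        \<longlonglongrightarrow> b \<bullet> gradient (\<lambda>v. h v s) x"
      by (rule filterlim_compose)
    then show "(\<lambda>k. (\<lambda>(x, s). (h (x + inverse (real (Suc k)) *\<^sub>R b) s - h x s) / inverse (real (Suc k))) p)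
        \<longlonglongrightarrow> (case p of (x, s) \<Rightarrow> gradient (\<lambda>v. h v s) x) \<bullet> b"
      by (simp add: ps inner_commute)
  next
    fix k
    have "(\<lambda>(x, s). h (x + inverse (real (Suc k)) *\<^sub>R b) s) \<in> borel_measurable (borel \<Otimes>\<^sub>M N)"
      using measurable_compose[OF _ h, of "\<lambda>p. (fst p + inverse (real (Suc k)) *\<^sub>R b, snd p)"]
      by (simp add: case_prod_beta')
    then show "(\<lambda>(x, s). (h (x + inverse (real (Suc k)) *\<^sub>R b) s - h x s) / inverse (real (Suc k)))
        \<in> borel_measurable (borel \<Otimes>\<^sub>M N)"
      using h unfolding case_prod_beta' by measurable
  qed
qed

section \<open>One gradient step at perturbed points\<close>

text \<open>Along the segment from \<open>u\<close> to \<open>v\<close> the difference of the two sides is nonincreasing.\<close>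

lemma lipschitz_gradient_quadratic_bound:
  fixes h :: "'a::real_inner \<Rightarrow> real"
  assumes deriv: "\<And>x. GDERIV h x :> g x"
    and lip: "\<And>u v. norm (g u - g v) \<le> L * norm (u - v)"
  shows "h v \<le> h u + g u \<bullet> (v - u) + L / 2 * (norm (v - u))\<^sup>2"
proof -
  define d where "d = v - u"
  define q where "q s = h (u + s *\<^sub>R d) - s * (d \<bullet> g u) - L / 2 * s\<^sup>2 * (norm d)\<^sup>2" for s :: real
  have "q 1 \<le> q 0"
  proof (rule DERIV_nonpos_imp_nonincreasing[where f=q and a=0 and b=1])
    fix s :: real assume s: "0 \<le> s" "s \<le> 1"
    have "(q has_real_derivative d \<bullet> g (u + s *\<^sub>R d) - d \<bullet> g u - L * s * (norm d)\<^sup>2) (at s)"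
      unfolding q_def by (auto intro!: derivative_eq_intros GDERIV_along_line deriv)
    moreover have "d \<bullet> g (u + s *\<^sub>R d) - d \<bullet> g u \<le> L * s * (norm d)\<^sup>2"
    proof -
      have "d \<bullet> g (u + s *\<^sub>R d) - d \<bullet> g u \<le> norm d * norm (g (u + s *\<^sub>R d) - g u)"
        by (simp add: inner_diff_right[symmetric] norm_cauchy_schwarz)
      also have "\<dots> \<le> norm d * (L * norm (s *\<^sub>R d))"
        using lip[of "u + s *\<^sub>R d" u] by (intro mult_left_mono) auto
      finally show ?thesis using s by (simp add: power2_eq_square mult_ac)
    qed
    ultimately show "\<exists>y. (q has_real_derivative y) (at s) \<and> y \<le> 0" by fastforce
  qed simp
  then show ?thesis by (simp add: q_def d_def inner_commute)
qed

lemma norm_sum_sq_le: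
  fixes v :: "'n::finite \<Rightarrow> 'a::real_inner"
  shows "(norm (\<Sum>i\<in>UNIV. v i))\<^sup>2 \<le> real CARD('n) * (\<Sum>i\<in>UNIV. (norm (v i))\<^sup>2)"
proof -
  have "(norm (\<Sum>i\<in>UNIV. v i))\<^sup>2 \<le> (\<Sum>i\<in>UNIV. norm (v i))\<^sup>2"
    by (intro power_mono norm_sum) simp
  also have "\<dots> \<le> real CARD('n) * (\<Sum>i\<in>UNIV. (norm (v i))\<^sup>2)"
    using Cauchy_Schwarz_ineq_sum[of "\<lambda>_. 1" "\<lambda>i. norm (v i)" UNIV] by simp
  finally show ?thesis .
qed

locale smooth_convex_family =
  fixes h :: "'n::finite \<Rightarrow> 'a::euclidean_space \<Rightarrow> real" and g :: "'n \<Rightarrow> 'a \<Rightarrow> 'a"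
    and L :: real and F :: "'a \<Rightarrow> real" and xs :: 'a
  assumes deriv: "\<And>i x. GDERIV (h i) x :> g i x"
    and L_pos: "0 < L"
    and lip: "\<And>i u v. norm (g i u - g i v) \<le> L * norm (u - v)"
    and tangent: "\<And>i u v. h i u + g i u \<bullet> (v - u) \<le> h i v"
    and F_def: "\<And>x. F x = (1 / real CARD('n)) * (\<Sum>i\<in>UNIV. h i x)"
    and minimal: "\<And>x. F xs \<le> F x"
begin

abbreviation G where "G x \<equiv> (1 / real CARD('n)) *\<^sub>R (\<Sum>i\<in>UNIV. g i x)"

lemma F_tangent: "F u + G u \<bullet> (v - u) \<le> F v"
proof -
  have "(\<Sum>i\<in>UNIV. h i u + g i u \<bullet> (v - u)) \<le> (\<Sum>i\<in>UNIV. h i v)"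
    by (intro sum_mono tangent)
  from mult_left_mono[OF this, of "1 / real CARD('n)"] show ?thesis
    by (simp add: F_def sum.distrib inner_sum_left add_divide_distrib)
qed

lemma F_quadratic_bound: "F v \<le> F u + G u \<bullet> (v - u) + L / 2 * (norm (v - u))\<^sup>2"
proof -
  have "(\<Sum>i\<in>UNIV. h i v) \<le> (\<Sum>i\<in>UNIV. h i u + g i u \<bullet> (v - u) + L / 2 * (norm (v - u))\<^sup>2)"
    by (intro sum_mono lipschitz_gradient_quadratic_bound deriv lip)
  from mult_left_mono[OF this, of "1 / real CARD('n)"] show ?thesis
    by (simp add: F_def sum.distrib inner_sum_left add_divide_distrib)
qed

text \<open>Minimality of \<open>xs\<close> is tested against one gradient step of length \<open>1 / L\<close> from \<open>x\<close>.\<close>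

lemma gradient_norm_sq_le_gap: "(norm (G x))\<^sup>2 \<le> 2 * L * (F x - F xs)"
proof -
  have "F xs \<le> F (x - (1 / L) *\<^sub>R G x)" by (rule minimal)
  also have "\<dots> \<le> F x + G x \<bullet> (- ((1 / L) *\<^sub>R G x)) + L / 2 * (norm ((1 / L) *\<^sub>R G x))\<^sup>2"
    using F_quadratic_bound[of "x - (1 / L) *\<^sub>R G x" x] by simp
  also have "\<dots> = F x - (norm (G x))\<^sup>2 / (2 * L)"
  proof -
    have "F x + v \<bullet> (- ((1 / L) *\<^sub>R v)) + L / 2 * (norm ((1 / L) *\<^sub>R v))\<^sup>2
      = F x - (norm v)\<^sup>2 / (2 * L)" for v :: 'a
    proof -
      have inner: "v \<bullet> (- ((1 / L) *\<^sub>R v)) = - ((norm v)\<^sup>2 / L)"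
        unfolding power2_norm_eq_inner by simp
      have sq: "L / 2 * (norm ((1 / L) *\<^sub>R v))\<^sup>2 = (norm v)\<^sup>2 / (2 * L)"
        using L_pos by (simp add: power_divide power2_eq_square[of L])
      show ?thesis unfolding inner sq using L_pos by (simp add: field_simps)
    qed
    then show ?thesis by this
  qed
  finally show ?thesis using L_pos by (simp add: field_simps)
qed

lemma gap_at_minimizer: "F x - F xs \<le> L / 2 * (norm (x - xs))\<^sup>2"
proof -
  have "(norm (G xs))\<^sup>2 \<le> 0" using gradient_norm_sq_le_gap[of xs] by simp
  then have "G xs = 0" by simp
  then show ?thesis using F_quadratic_bound[of x xs] by simp
qed

text \<open>Jensen's inequality: average the tangent inequalities at the mean point.\<close>

lemma F_average_le:
  assumes "0 < (T::nat)"
  shows "F ((1 / real T) *\<^sub>R (\<Sum>t<T. x t)) \<le> (1 / real T) * (\<Sum>t<T. F (x t))"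
proof -
  define m where "m = (1 / real T) *\<^sub>R (\<Sum>t<T. x t)"
  have m: "(\<Sum>t<T. x t - m) = 0"
    using assms by (simp add: m_def sum_subtractf sum_constant_scaleR)
  have "(\<Sum>t<T. F m + G m \<bullet> (x t - m)) \<le> (\<Sum>t<T. F (x t))"
    by (intro sum_mono F_tangent)
  then have "real T * F m \<le> (\<Sum>t<T. F (x t))"
    by (simp only: sum.distrib inner_sum_right[symmetric] m) simp
  then show ?thesis using assms by (simp add: m_def[symmetric] field_simps)
qed

text \<open>A gradient step whose component gradients are taken at points \<open>z i\<close> near \<open>x\<close> still decreases
  the distance to \<open>xs\<close> in proportion to the optimality gap, up to the squared deviations of the
  \<open>z i\<close>. For the linear term, convexity compares \<open>z i\<close> with \<open>xs\<close> and smoothness compares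
  \<open>z i\<close> with \<open>x\<close>; the quadratic term is bounded by the gradient at \<open>x\<close>, hence by the
  gap, plus a Lipschitz correction. The condition on \<open>\<eta>\<close> leaves half of the linear gain.\<close>

lemma perturbed_step:
  assumes \<eta>: "0 \<le> \<eta>" "4 * L * \<eta> \<le> 1"
  shows "(norm (x - xs - (\<eta> / real CARD('n)) *\<^sub>R (\<Sum>i\<in>UNIV. g i (z i))))\<^sup>2
    \<le> (norm (x - xs))\<^sup>2 - \<eta> * (F x - F xs)
       + 3 * \<eta> * L / (2 * real CARD('n)) * (\<Sum>i\<in>UNIV. (norm (z i - x))\<^sup>2)"
proof -
  define n where "n = real CARD('n)"
  have n: "0 < n" by (simp add: n_def)
  define S where "S = (1 / n) *\<^sub>R (\<Sum>i\<in>UNIV. g i (z i))"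
  define Dz where "Dz = (\<Sum>i\<in>UNIV. (norm (z i - x))\<^sup>2)"
  define \<Delta> where "\<Delta> = F x - F xs"
  have \<Delta>: "0 \<le> \<Delta>" using minimal by (simp add: \<Delta>_def)
  have Dz: "0 \<le> Dz" by (simp add: Dz_def sum_nonneg)
  have inner: "\<Delta> - L / (2 * n) * Dz \<le> (x - xs) \<bullet> S"
  proof -
    have "h i x - h i xs - L / 2 * (norm (z i - x))\<^sup>2 \<le> (x - xs) \<bullet> g i (z i)" for i
      using tangent[of i "z i" xs]
        lipschitz_gradient_quadratic_bound[OF deriv lip, of i x "z i"]
      by (simp add: inner_diff_right inner_diff_left inner_commute norm_minus_commute)
    then have "(\<Sum>i\<in>UNIV. h i x - h i xs - L / 2 * (norm (z i - x))\<^sup>2)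
        \<le> (\<Sum>i\<in>UNIV. (x - xs) \<bullet> g i (z i))" by (intro sum_mono)
    then have "n * \<Delta> - L / 2 * Dz \<le> n * ((x - xs) \<bullet> S)"
      using n by (simp add: \<Delta>_def Dz_def F_def S_def n_def[symmetric] sum_subtractf
        sum_distrib_left inner_sum_right right_diff_distrib)
    then show ?thesis using n by (simp add: field_simps)
  qed
  have norm_S: "(norm S)\<^sup>2 \<le> 2 * L\<^sup>2 / n * Dz + 4 * L * \<Delta>"
  proof -
    have "(norm (S - G x))\<^sup>2 = (1 / n)\<^sup>2 * (norm (\<Sum>i\<in>UNIV. g i (z i) - g i x))\<^sup>2"
      by (simp add: S_def n_def scaleR_diff_right[symmetric] sum_subtractf power_mult_distrib power_divide)
    also have "\<dots> \<le> (1 / n)\<^sup>2 * (n * (\<Sum>i\<in>UNIV. (norm (g i (z i) - g i x))\<^sup>2))"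
      unfolding n_def by (intro mult_left_mono norm_sum_sq_le) simp
    also have "\<dots> \<le> (1 / n)\<^sup>2 * (n * (\<Sum>i\<in>UNIV. L\<^sup>2 * (norm (z i - x))\<^sup>2))"
    proof (intro mult_left_mono sum_mono)
      show "(norm (g i (z i) - g i x))\<^sup>2 \<le> L\<^sup>2 * (norm (z i - x))\<^sup>2" for i
        using power_mono[OF lip[of i "z i" x], of 2] by (simp add: power_mult_distrib)
    qed (use n in auto)
    also have "\<dots> = L\<^sup>2 / n * Dz"
      using n by (simp add: Dz_def sum_distrib_left[symmetric] power2_eq_square)
    finally have 1: "(norm (S - G x))\<^sup>2 \<le> L\<^sup>2 / n * Dz" .
    have "(norm S)\<^sup>2 \<le> 2 * (norm (S - G x))\<^sup>2 + 2 * (norm (G x))\<^sup>2"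
      using norm_add_sq_le[of 1 1 "S - G x" "G x"] by simp
    with 1 gradient_norm_sq_le_gap[of x] show ?thesis by (simp add: \<Delta>_def)
  qed
  have "(norm (x - xs - \<eta> *\<^sub>R S))\<^sup>2 = (norm (x - xs))\<^sup>2 - 2 * \<eta> * ((x - xs) \<bullet> S) + \<eta>\<^sup>2 * (norm S)\<^sup>2"
  proof -
    have "(norm (a - \<eta> *\<^sub>R S))\<^sup>2 = (norm a)\<^sup>2 - 2 * \<eta> * (a \<bullet> S) + \<eta>\<^sup>2 * (norm S)\<^sup>2" for a
      unfolding power2_norm_eq_inner
      by (simp add: inner_diff_left inner_diff_right inner_commute power2_eq_square)
    then show ?thesis .
  qed
  also have "\<dots> \<le> (norm (x - xs))\<^sup>2 - 2 * \<eta> * (\<Delta> - L / (2 * n) * Dz)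
      + \<eta>\<^sup>2 * (2 * L\<^sup>2 / n * Dz + 4 * L * \<Delta>)"
    using inner norm_S \<eta> by (intro add_mono diff_left_mono mult_left_mono) auto
  also have "\<dots> = (norm (x - xs))\<^sup>2 - \<eta> * \<Delta> * (2 - 4 * L * \<eta>)
      + \<eta> * L * Dz / n * (1 + 2 * L * \<eta>)"
    by (simp add: algebra_simps power2_eq_square add_divide_distrib)
  also have "\<dots> \<le> (norm (x - xs))\<^sup>2 - \<eta> * \<Delta> * 1 + \<eta> * L * Dz / n * (3 / 2)"
    using \<eta> \<Delta> Dz n L_pos by (intro add_mono diff_left_mono mult_left_mono) auto
  finally show ?thesis
    by (simp add: S_def Dz_def \<Delta>_def n_def mult_ac)
qed

end

section \<open>Contraction of the damped mixing matrix\<close>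

lemma matrix_pow_Suc_right: "matrix_pow A (Suc k) = matrix_pow A k ** A"
  by (induction k) (simp_all add: matrix_mul_assoc)

lemma matrix_add_rdistrib': "((A::real^'n^'m) + B) ** X = A ** X + B ** X"
  by (simp add: vec_eq_iff matrix_matrix_mult_def sum.distrib distrib_right)

lemma matrix_diff_rdistrib: "((A::real^'n^'m) - B) ** X = A ** X - B ** X"
  by (simp add: vec_eq_iff matrix_matrix_mult_def sum_subtractf left_diff_distrib)

lemma matrix_diff_ldistrib: "(A::real^'n^'m) ** (X - Y) = A ** X - A ** Y"
  by (simp add: vec_eq_iff matrix_matrix_mult_def sum_subtractf right_diff_distrib)

lemma matrix_scaleR_left: "(c *\<^sub>R (A::real^'n^'m)) ** X = c *\<^sub>R (A ** X)"
  by (simp add: vec_eq_iff matrix_matrix_mult_def sum_distrib_left mult_ac)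

lemma matrix_scaleR_right: "(A::real^'n^'m) ** (c *\<^sub>R X) = c *\<^sub>R (A ** X)"
  by (simp add: vec_eq_iff matrix_matrix_mult_def sum_distrib_left mult_ac)

lemmas matrix_linear_simps = matrix_add_ldistrib matrix_add_rdistrib' matrix_diff_rdistrib
  matrix_diff_ldistrib matrix_scaleR_left matrix_scaleR_right

text \<open>The consensus stepsize makes the iteration mix with a lazy version of \<open>W\<close>.\<close>

definition damped :: "real \<Rightarrow> real^'n^'n \<Rightarrow> real^'n^'n" where
  "damped \<gamma> W = (1 - \<gamma>) *\<^sub>R mat 1 + \<gamma> *\<^sub>R W"

text \<open>Expanding \<open>((1 - \<gamma>) I + \<gamma> W)^k\<close> binomially, a geometric rate \<open>1 - \<delta>\<close> for the powers of
  \<open>W\<close> becomes the rate \<open>(1 - \<gamma>) + \<gamma> (1 - \<delta>)\<close> with the same constant. The induction carries an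
  extra power of \<open>W\<close> along, which replaces the binomial sum.\<close>

lemma damped_contraction:
  fixes W P :: "real^'n^'n" and X :: "real^'d^'n"
  assumes \<gamma>: "0 \<le> \<gamma>" "\<gamma> \<le> 1"
    and W: "\<And>j (X::real^'d^'n). norm (matrix_pow W j ** X - P ** X) \<le> C * (1 - \<delta>) ^ j * norm X"
  shows "norm (matrix_pow (damped \<gamma> W) k ** X - P ** X) \<le> C * (1 - \<gamma> * \<delta>) ^ k * norm X"
proof -
  let ?D = "matrix_pow (damped \<gamma> W)"
  have "norm (?D k ** (matrix_pow W j ** X) - P ** X)
      \<le> C * (1 - \<gamma> * \<delta>) ^ k * (1 - \<delta>) ^ j * norm X" for j
  proof (induction k arbitrary: j)
    case 0
    show ?case using W[of j X] by simp
  next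
    case (Suc k)
    let ?a = "\<lambda>j. ?D k ** (matrix_pow W j ** X) - P ** X"
    have "?D (Suc k) ** (matrix_pow W j ** X) - P ** X = (1 - \<gamma>) *\<^sub>R ?a j + \<gamma> *\<^sub>R ?a (Suc j)"
      unfolding matrix_pow_Suc_right[of "damped \<gamma> W" k]
      by (simp add: damped_def matrix_linear_simps matrix_mul_assoc[symmetric])
        (simp add: algebra_simps)
    also have "norm \<dots> \<le> (1 - \<gamma>) * norm (?a j) + \<gamma> * norm (?a (Suc j))"
      using \<gamma> norm_triangle_ineq[of "(1 - \<gamma>) *\<^sub>R ?a j" "\<gamma> *\<^sub>R ?a (Suc j)"] by simp
    also have "\<dots> \<le> (1 - \<gamma>) * (C * (1 - \<gamma> * \<delta>) ^ k * (1 - \<delta>) ^ j * norm X)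
        + \<gamma> * (C * (1 - \<gamma> * \<delta>) ^ k * (1 - \<delta>) ^ Suc j * norm X)"
      using \<gamma> by (intro add_mono mult_left_mono Suc.IH) auto
    also have "\<dots> = C * (1 - \<gamma> * \<delta>) ^ Suc k * (1 - \<delta>) ^ j * norm X"
      by (simp add: algebra_simps)
    finally show ?case .
  qed
  from this[of 0] show ?thesis by simp
qed

section \<open>The algorithm and its randomness\<close>

lemma Int_stable_vimages: "Int_stable {f -` A \<inter> S | A. A \<in> sets N}"
proof (rule Int_stableI)
  fix a b assume "a \<in> {f -` A \<inter> S | A. A \<in> sets N}" "b \<in> {f -` A \<inter> S | A. A \<in> sets N}"
  then obtain A B where "A \<in> sets N" "B \<in> sets N" "a = f -` A \<inter> S" "b = f -` B \<inter> S"
    by blast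
  then have "a \<inter> b = f -` (A \<inter> B) \<inter> S" "A \<inter> B \<in> sets N" by auto
  then show "a \<inter> b \<in> {f -` A \<inter> S | A. A \<in> sets N}" by blast
qed

text \<open>The setting of the theorem for an arbitrary stepsize \<open>\<eta> \<le> 1 / (4 L)\<close> and without a horizon;
  the estimates below hold at every time.\<close>

locale push_sum_sgd =
  fixes W :: "real^'n::finite^'n"
    and \<phi> :: "real^'n"
    and \<delta> C \<kappa> \<beta> \<omega> \<sigma> G L \<gamma> \<eta> :: real
    and D :: "'n \<Rightarrow> 's measure"
    and ft :: "'n \<Rightarrow> real^'d::finite \<Rightarrow> 's \<Rightarrow> real"
    and R :: "'q measure"
    and Q :: "real^'d \<Rightarrow> 'q \<Rightarrow> real^'d"
    and M :: "'w measure"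
    and \<xi> :: "'n \<Rightarrow> nat \<Rightarrow> 'w \<Rightarrow> 's"
    and \<rho> :: "'n \<Rightarrow> nat \<Rightarrow> 'w \<Rightarrow> 'q"
    and X Xh U Z :: "nat \<Rightarrow> 'w \<Rightarrow> real^'d^'n"
    and y :: "nat \<Rightarrow> real^'n"
    and xstar :: "real^'d"
  assumes column_stochastic: "vec 1 v* W = vec 1"
    and beta: "\<beta> = spectral_norm (W - mat 1)"
    and delta: "0 < \<delta>" "\<delta> \<le> 1"
    and C_pos: "0 < C"
    and kappa_pos: "0 < \<kappa>"
    and phi_fixed: "W *v \<phi> = \<phi>"
    and kappa: "\<And>t i. \<kappa> \<le> (matrix_pow W t *v vec 1) $ i"
    and ergodic: "\<And>t. spectral_norm (matrix_pow W t - outer_prod \<phi> (vec 1)) \<le> C * (1 - \<delta>) ^ t"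
    and omega: "0 < \<omega>" "\<omega> \<le> 1"
    and compression: "compression_operator \<omega> R Q"
    and problem: "stochastic_problem D ft"
    and bounded_variance: "\<And>i x.
      (\<integral>\<^sup>+s. ennreal ((norm (stoch_grad ft i x s - gradient (local_loss D ft i) x))\<^sup>2) \<partial>D i)
        \<le> ennreal (\<sigma>\<^sup>2)"
    and bounded_gradients: "\<And>i x.
      (\<integral>\<^sup>+s. ennreal ((norm (stoch_grad ft i x s))\<^sup>2) \<partial>D i) \<le> ennreal (G\<^sup>2)"
    and L_pos: "0 < L"
    and smooth: "\<And>i u v.
      norm (gradient (local_loss D ft i) u - gradient (local_loss D ft i) v) \<le> L * norm (u - v)"
    and convex: "\<And>i u v.
      local_loss D ft i u + gradient (local_loss D ft i) u \<bullet> (v - u) \<le> local_loss D ft i v"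
    and minimizer: "is_arg_min (global_loss D ft) (\<lambda>_. True) xstar"
    and stepsize: "0 < \<eta>" "4 * L * \<eta> \<le> 1"
    and gamma: "\<gamma> = \<omega> * \<delta> / (12 * \<beta> * (\<beta> + 1) * (C + 1))"
    and gamma_range: "0 < \<gamma>" "\<gamma> \<le> 1"
    and randomness: "algorithm_randomness M D R \<xi> \<rho>"
    and iteration: "compressed_push_sum_sgd W ft Q \<gamma> \<eta> M \<xi> \<rho> X Xh U Z y"
    and init: "\<And>w. w \<in> space M \<Longrightarrow> X 0 w = 0" "\<And>w. w \<in> space M \<Longrightarrow> Xh 0 w = 0" "y 0 = vec 1"
begin

sublocale prob_space M
  using randomness by (simp add: algorithm_randomness_def)

abbreviation grad :: "'n \<Rightarrow> real^'d \<Rightarrow> real^'d" where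
  "grad i \<equiv> gradient (local_loss D ft i)"

sublocale loss: smooth_convex_family "local_loss D ft" grad L "global_loss D ft" xstar
proof
  show "GDERIV (local_loss D ft i) x :> grad i x" for i x
    using problem by (intro GDERIV_gradient) (auto simp: stochastic_problem_def)
  show "global_loss D ft xstar \<le> global_loss D ft x" for x
    using minimizer by (auto simp: is_arg_min_def not_less)
qed (fact L_pos smooth convex global_loss_def)+

lemma iteration_step:
  assumes "w \<in> space M"
  shows "Xh (Suc t) w $ i = Xh t w $ i + Q (X t w $ i - Xh t w $ i) (\<rho> i t w)"
    and "U (Suc t) w = X t w + \<gamma> *\<^sub>R ((W - mat 1) ** Xh (Suc t) w)"
    and "Z (Suc t) w $ i = U (Suc t) w $ i /\<^sub>R (y (Suc t) $ i)"
    and "X (Suc t) w $ i = U (Suc t) w $ i - \<eta> *\<^sub>R stoch_grad ft i (Z (Suc t) w $ i) (\<xi> i (Suc t) w)"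
  using iteration assms unfolding compressed_push_sum_sgd_def by simp_all

lemma y_eq: "y t = matrix_pow W t *v vec 1"
proof (induction t)
  case (Suc t)
  have "y (Suc t) = W *v y t"
    using iteration unfolding compressed_push_sum_sgd_def by simp
  with Suc show ?case by (simp add: matrix_vector_mul_assoc)
qed (simp add: init)

text \<open>The family generated by one sample (left) or one compression seed (right).\<close>

definition events_of :: "('n \<times> nat) + ('n \<times> nat) \<Rightarrow> 'w set set" where
  "events_of k = (case k of
     Inl (i, t) \<Rightarrow> {\<xi> i t -` A \<inter> space M | A. A \<in> sets (D i)}
   | Inr (i, t) \<Rightarrow> {\<rho> i t -` A \<inter> space M | A. A \<in> sets R})"

text \<open>Sets of random inputs, as seen at increasing stages of one round. \<open>past t\<close> determines the iterate
  \<open>X t\<close>. \<open>sent t\<close> adds the compression seeds of the round and determines \<open>Z (Suc t)\<close>, where the next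
  gradients are evaluated. \<open>others t i\<close> adds the new samples of all agents except \<open>i\<close>, so that the
  sample of agent \<open>i\<close> is independent even of the gradient noise of the others.\<close>

definition past :: "nat \<Rightarrow> (('n \<times> nat) + ('n \<times> nat)) set" where
  "past t = {Inl (i, s) |i s. s \<le> t} \<union> {Inr (i, s) |i s. s < t}"

definition sent :: "nat \<Rightarrow> (('n \<times> nat) + ('n \<times> nat)) set" where
  "sent t = {Inl (i, s) |i s. s \<le> t} \<union> {Inr (i, s) |i s. s \<le> t}"

definition others :: "nat \<Rightarrow> 'n \<Rightarrow> (('n \<times> nat) + ('n \<times> nat)) set" where
  "others t i = sent t \<union> {Inl (j, Suc t) |j. j \<noteq> i}"

abbreviation alg where "alg \<equiv> generated_algebra M events_of"

lemma past_sent: "past t \<subseteq> sent t" and sent_past: "sent t \<subseteq> past (Suc t)"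
  and sent_others: "sent t \<subseteq> others t i"
  by (auto simp: past_def sent_def others_def)

lemma xi_measurable: "\<xi> i t \<in> measurable M (D i)" and xi_distr: "distr M (D i) (\<xi> i t) = D i"
  and rho_measurable: "\<rho> i t \<in> measurable M R" and rho_distr: "distr M R (\<rho> i t) = R"
  using randomness by (auto simp: algorithm_randomness_def)

lemma indep_events_of: "indep_sets events_of UNIV"
  using randomness by (simp add: algorithm_randomness_def events_of_def[abs_def])

lemma events_of_Pow: "events_of k \<subseteq> Pow (space M)"
  by (auto simp: events_of_def split: sum.splits)

lemma Int_stable_events_of: "Int_stable (events_of k)"
  by (cases k) (auto simp: events_of_def intro: Int_stable_vimages)

lemma xi_event: "B \<in> sets (D i) \<Longrightarrow> \<xi> i t -` B \<inter> space M \<in> events_of (Inl (i, t))"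
  and rho_event: "B' \<in> sets R \<Longrightarrow> \<rho> i t -` B' \<inter> space M \<in> events_of (Inr (i, t))"
  unfolding events_of_def by auto

lemma space_alg: "space (alg K) = space M"
  unfolding generated_algebra_def using events_of_Pow by (intro space_measure_of) blast

lemma alg_mono: "f \<in> measurable (alg K) N \<Longrightarrow> K \<subseteq> K' \<Longrightarrow> f \<in> measurable (alg K') N"
  by (rule generated_algebra_mono[OF events_of_Pow])

lemma alg_measurable_M:
  assumes "f \<in> measurable (alg K) N" shows "f \<in> measurable M N"
proof (rule measurable_from_subalg[OF _ assms])
  have "sigma_sets (space M) (\<Union>k\<in>K. events_of k) \<subseteq> sets M"
    using indep_events_of by (intro sets.sigma_sets_subset) (auto simp: indep_sets_def)
  moreover have "(\<Union>k\<in>K. events_of k) \<subseteq> Pow (space M)" using events_of_Pow by blast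
  ultimately show "subalgebra M (alg K)"
    by (simp add: subalgebra_def generated_algebra_def space_measure_of sets_measure_of)
qed

lemma xi_alg: "Inl (i, t) \<in> K \<Longrightarrow> \<xi> i t \<in> measurable (alg K) (D i)"
  by (rule measurable_generated_algebra[where \<A>=events_of and k="Inl (i, t)", OF events_of_Pow _ xi_measurable xi_event])

lemma rho_alg: "Inr (i, t) \<in> K \<Longrightarrow> \<rho> i t \<in> measurable (alg K) R"
  by (rule measurable_generated_algebra[where \<A>=events_of and k="Inr (i, t)", OF events_of_Pow _ rho_measurable rho_event])

lemma rho_fresh: "fresh_for M (alg (past t)) R (\<rho> i t)"
  by (rule fresh_for_generated_algebra[where \<A>=events_of and k="Inr (i, t)",
      OF prob_space_axioms indep_events_of Int_stable_events_of _
      rho_measurable rho_distr rho_event]) (simp add: past_def)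

lemma xi_fresh: "fresh_for M (alg (others t i)) (D i) (\<xi> i (Suc t))"
  by (rule fresh_for_generated_algebra[where \<A>=events_of and k="Inl (i, Suc t)",
      OF prob_space_axioms indep_events_of Int_stable_events_of _
      xi_measurable xi_distr xi_event]) (simp add: others_def sent_def)

lemma stoch_grad_measurable:
  "(\<lambda>(x, s). stoch_grad ft i x s) \<in> borel_measurable (borel \<Otimes>\<^sub>M D i)"
  unfolding stoch_grad_def
  using problem by (intro measurable_gradient_pair)
    (auto simp: stochastic_problem_def intro: borel_measurable_integrable)

lemma stoch_grad_compose:
  assumes "f \<in> borel_measurable F" "g \<in> measurable F (D i)"
  shows "(\<lambda>w. stoch_grad ft i (f w) (g w)) \<in> borel_measurable F"
  using measurable_compose[OF measurable_Pair[OF assms] stoch_grad_measurable] by simp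

lemma Q_compose:
  assumes "f \<in> borel_measurable F" "g \<in> measurable F R"
  shows "(\<lambda>w. Q (f w) (g w)) \<in> borel_measurable F"
proof -
  have "(\<lambda>(x, r). Q x r) \<in> borel_measurable (borel \<Otimes>\<^sub>M R)"
    using compression by (simp add: compression_operator_def)
  from measurable_compose[OF measurable_Pair[OF assms] this] show ?thesis by simp
qed

lemma grad_measurable: "grad i \<in> borel_measurable borel"
proof (rule borel_measurable_continuous_onI)
  have "L-lipschitz_on UNIV (grad i)"
    using L_pos smooth by (intro lipschitz_onI) (auto simp: dist_norm)
  then show "continuous_on UNIV (grad i)" by (rule lipschitz_on_continuous_on)
qed

lemma matrix_mult_measurable:
  fixes f :: "'w \<Rightarrow> real^'d^'n"
  assumes "f \<in> borel_measurable F" shows "(\<lambda>w. A ** f w) \<in> borel_measurable F"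
proof (rule measurable_compose[OF assms], rule borel_measurable_continuous_onI)
  show "continuous_on UNIV ((**) A :: real^'d^'n \<Rightarrow> _)"
    by (rule linear_continuous_on, rule linear_conv_bounded_linear[THEN iffD1])
      (auto intro!: linearI simp: matrix_linear_simps)
qed

text \<open>The defining equations hold on the sample space only, so each iterate agrees there with a
  measurable expression in earlier ones and in the inputs of the round.\<close>

lemma iterate_measurable_step:
  assumes X: "X t \<in> borel_measurable (alg (past t))" and Xh: "Xh t \<in> borel_measurable (alg (past t))"
  shows "Xh (Suc t) \<in> borel_measurable (alg (sent t))"
    and "U (Suc t) \<in> borel_measurable (alg (sent t))"
    and "Z (Suc t) \<in> borel_measurable (alg (sent t))"
    and "X (Suc t) \<in> borel_measurable (alg (past (Suc t)))"
proof -
  note X' = alg_mono[OF X past_sent] and Xh' = alg_mono[OF Xh past_sent]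
  note [measurable] = borel_measurable_row[OF X'] borel_measurable_row[OF Xh']
  show Xh_Suc: "Xh (Suc t) \<in> borel_measurable (alg (sent t))"
  proof (rule borel_measurable_rows)
    fix i
    have [measurable]: "(\<lambda>w. Q (X t w $ i - Xh t w $ i) (\<rho> i t w)) \<in> borel_measurable (alg (sent t))"
      by (rule Q_compose) (measurable, auto intro: rho_alg simp: sent_def)
    have "(\<lambda>w. Xh t w $ i + Q (X t w $ i - Xh t w $ i) (\<rho> i t w)) \<in> borel_measurable (alg (sent t))"
      by measurable
    then show "(\<lambda>w. Xh (Suc t) w $ i) \<in> borel_measurable (alg (sent t))"
      by (rule measurable_cong[THEN iffD1, rotated]) (simp add: space_alg iteration_step)
  qed
  show U_Suc: "U (Suc t) \<in> borel_measurable (alg (sent t))"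
  proof (rule measurable_cong[THEN iffD1, rotated])
    show "(\<lambda>w. X t w + \<gamma> *\<^sub>R ((W - mat 1) ** Xh (Suc t) w)) \<in> borel_measurable (alg (sent t))"
      using X' matrix_mult_measurable[OF Xh_Suc, of "W - mat 1"] by measurable
  qed (simp add: space_alg iteration_step)
  note [measurable] = borel_measurable_row[OF U_Suc]
  show Z_Suc: "Z (Suc t) \<in> borel_measurable (alg (sent t))"
  proof (rule borel_measurable_rows)
    fix i
    have "(\<lambda>w. U (Suc t) w $ i /\<^sub>R (y (Suc t) $ i)) \<in> borel_measurable (alg (sent t))"
      by measurable
    then show "(\<lambda>w. Z (Suc t) w $ i) \<in> borel_measurable (alg (sent t))"
      by (rule measurable_cong[THEN iffD1, rotated]) (simp add: space_alg iteration_step)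
  qed
  show "X (Suc t) \<in> borel_measurable (alg (past (Suc t)))"
  proof (rule borel_measurable_rows)
    fix i
    note [measurable] = borel_measurable_row[OF alg_mono[OF U_Suc sent_past]]
    have [measurable]: "(\<lambda>w. stoch_grad ft i (Z (Suc t) w $ i) (\<xi> i (Suc t) w))
        \<in> borel_measurable (alg (past (Suc t)))"
      by (intro stoch_grad_compose borel_measurable_row[OF alg_mono[OF Z_Suc sent_past]] xi_alg)
        (simp add: past_def)
    have "(\<lambda>w. U (Suc t) w $ i - \<eta> *\<^sub>R stoch_grad ft i (Z (Suc t) w $ i) (\<xi> i (Suc t) w))
        \<in> borel_measurable (alg (past (Suc t)))"
      by measurable
    then show "(\<lambda>w. X (Suc t) w $ i) \<in> borel_measurable (alg (past (Suc t)))"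
      by (rule measurable_cong[THEN iffD1, rotated]) (simp add: space_alg iteration_step)
  qed
qed

lemma iterates_adapted:
  "X t \<in> borel_measurable (alg (past t)) \<and> Xh t \<in> borel_measurable (alg (past t))"
proof (induction t)
  case 0
  have "(\<lambda>w. 0 :: real^'d^'n) \<in> borel_measurable (alg (past 0))" by simp
  then have "X 0 \<in> borel_measurable (alg (past 0))" "Xh 0 \<in> borel_measurable (alg (past 0))"
    by (rule measurable_cong[THEN iffD1, rotated], simp add: space_alg init)+
  then show ?case ..
next
  case (Suc t)
  then show ?case
    using iterate_measurable_step alg_mono[OF _ sent_past] by blast
qed

lemmas X_adapted = iterates_adapted[THEN conjunct1] and Xh_adapted = iterates_adapted[THEN conjunct2]
lemmas Z_adapted = iterate_measurable_step(3)[OF X_adapted Xh_adapted]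

definition sampled_grad :: "nat \<Rightarrow> 'w \<Rightarrow> real^'d^'n" where
  "sampled_grad t w = (\<chi> i. stoch_grad ft i (Z t w $ i) (\<xi> i t w))"

text \<open>The part of the sampled gradient that averages out; \<open>t\<close> is positive wherever it is used, since
  \<open>Z\<close> is determined from index one on.\<close>

definition noise :: "nat \<Rightarrow> 'n \<Rightarrow> 'w \<Rightarrow> real^'d" where
  "noise t i w = sampled_grad t w $ i - grad i (Z t w $ i)"

definition compression_error :: "nat \<Rightarrow> 'w \<Rightarrow> real^'d^'n" where
  "compression_error t w = Xh (Suc t) w - X t w"

lemma Z_others: "(\<lambda>w. Z (Suc t) w $ j) \<in> borel_measurable (alg (others t i))"
  by (intro borel_measurable_row alg_mono[OF Z_adapted sent_others])

lemma sampled_grad_row_alg: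
  assumes "sent t \<subseteq> K" "Inl (i, Suc t) \<in> K"
  shows "(\<lambda>w. sampled_grad (Suc t) w $ i) \<in> borel_measurable (alg K)"
  unfolding sampled_grad_def using assms
  by (simp, intro stoch_grad_compose borel_measurable_row[OF alg_mono[OF Z_adapted]] xi_alg)

lemma noise_alg:
  assumes "sent t \<subseteq> K" "Inl (i, Suc t) \<in> K"
  shows "noise (Suc t) i \<in> borel_measurable (alg K)"
  unfolding noise_def[abs_def]
  by (intro borel_measurable_diff sampled_grad_row_alg assms
      measurable_compose[OF borel_measurable_row[OF alg_mono[OF Z_adapted]] grad_measurable])

lemma sampled_grad_row_l2: "l2_bounded M (\<lambda>w. sampled_grad (Suc t) w $ i) \<bar>G\<bar>"
proof -
  have [measurable]: "(\<lambda>p. stoch_grad ft i (Z (Suc t) (fst p) $ i) (snd p))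
      \<in> borel_measurable (alg (others t i) \<Otimes>\<^sub>M D i)"
    by (intro stoch_grad_compose measurable_compose[OF measurable_fst Z_others] measurable_snd)
  have "(\<integral>\<^sup>+w. ennreal ((norm (sampled_grad (Suc t) w $ i))\<^sup>2) \<partial>M)
      = (\<integral>\<^sup>+w. (\<lambda>p. ennreal ((norm (stoch_grad ft i (Z (Suc t) (fst p) $ i) (snd p)))\<^sup>2)) (w, \<xi> i (Suc t) w) \<partial>M)"
    by (simp add: sampled_grad_def)
  also have "\<dots> = (\<integral>\<^sup>+w. \<integral>\<^sup>+s. ennreal ((norm (stoch_grad ft i (Z (Suc t) w $ i) s))\<^sup>2) \<partial>D i \<partial>M)"
    by (subst nn_integral_freeze[OF xi_fresh]) simp_all
  also have "\<dots> \<le> (\<integral>\<^sup>+w. ennreal (G\<^sup>2) \<partial>M)"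
    by (intro nn_integral_mono bounded_gradients)
  also have "\<dots> = ennreal (\<bar>G\<bar>\<^sup>2)" by (simp add: emeasure_space_1)
  moreover have "(\<lambda>w. sampled_grad (Suc t) w $ i) \<in> borel_measurable M"
    by (rule alg_measurable_M[OF sampled_grad_row_alg[where K=UNIV]]) auto
  ultimately show ?thesis by (simp add: l2_bounded_def)
qed

lemma noise_l2: "l2_bounded M (noise (Suc t) i) \<bar>\<sigma>\<bar>"
proof -
  have [measurable]: "(\<lambda>p. stoch_grad ft i (Z (Suc t) (fst p) $ i) (snd p) - grad i (Z (Suc t) (fst p) $ i))
      \<in> borel_measurable (alg (others t i) \<Otimes>\<^sub>M D i)"
    by (intro borel_measurable_diff stoch_grad_compose measurable_compose[OF measurable_fst Z_others]
        measurable_snd measurable_compose[OF measurable_compose[OF measurable_fst Z_others] grad_measurable])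
  have "(\<integral>\<^sup>+w. ennreal ((norm (noise (Suc t) i w))\<^sup>2) \<partial>M)
      = (\<integral>\<^sup>+w. (\<lambda>p. ennreal ((norm (stoch_grad ft i (Z (Suc t) (fst p) $ i) (snd p)
            - grad i (Z (Suc t) (fst p) $ i)))\<^sup>2)) (w, \<xi> i (Suc t) w) \<partial>M)"
    by (simp add: noise_def sampled_grad_def)
  also have "\<dots> = (\<integral>\<^sup>+w. \<integral>\<^sup>+s. ennreal ((norm (stoch_grad ft i (Z (Suc t) w $ i) s
      - grad i (Z (Suc t) w $ i)))\<^sup>2) \<partial>D i \<partial>M)"
    by (subst nn_integral_freeze[OF xi_fresh]) simp_all
  also have "\<dots> \<le> (\<integral>\<^sup>+w. ennreal (\<sigma>\<^sup>2) \<partial>M)"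
    by (intro nn_integral_mono bounded_variance)
  also have "\<dots> = ennreal (\<bar>\<sigma>\<bar>\<^sup>2)" by (simp add: emeasure_space_1)
  moreover have "noise (Suc t) i \<in> borel_measurable M"
    by (rule alg_measurable_M[OF noise_alg[where K=UNIV]]) auto
  ultimately show ?thesis by (simp add: l2_bounded_def)
qed

text \<open>Unbiasedness at the random point \<open>Z\<close>: with all other inputs frozen, the noise of agent \<open>i\<close> has mean
  zero. It is used with \<open>H\<close> the deterministic part of the step and with \<open>H\<close> the noise of another agent.\<close>

lemma noise_orthogonal:
  assumes H: "H \<in> borel_measurable (alg (others t i))" and H2: "l2_bounded M H a"
  shows "(\<integral>w. H w \<bullet> noise (Suc t) i w \<partial>M) = 0"
proof -
  let ?\<phi> = "\<lambda>p. H (fst p) \<bullet> (stoch_grad ft i (Z (Suc t) (fst p) $ i) (snd p) - grad i (Z (Suc t) (fst p) $ i))"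
  have [measurable]: "(\<lambda>p. stoch_grad ft i (Z (Suc t) (fst p) $ i) (snd p) - grad i (Z (Suc t) (fst p) $ i))
      \<in> borel_measurable (alg (others t i) \<Otimes>\<^sub>M D i)"
    by (intro borel_measurable_diff stoch_grad_compose measurable_compose[OF measurable_fst Z_others]
        measurable_snd measurable_compose[OF measurable_compose[OF measurable_fst Z_others] grad_measurable])
  have [measurable]: "(\<lambda>p. H (fst p)) \<in> borel_measurable (alg (others t i) \<Otimes>\<^sub>M D i)"
    by (rule measurable_compose[OF measurable_fst H])
  have eq: "H w \<bullet> noise (Suc t) i w = ?\<phi> (w, \<xi> i (Suc t) w)" for w
    by (simp add: noise_def sampled_grad_def)
  have "(\<integral>w. ?\<phi> (w, \<xi> i (Suc t) w) \<partial>M) = 0"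
  proof (rule integral_freeze_eq_zero[OF xi_fresh])
    show "?\<phi> \<in> borel_measurable (alg (others t i) \<Otimes>\<^sub>M D i)" by measurable
    show "integrable M (\<lambda>w. ?\<phi> (w, \<xi> i (Suc t) w))"
      using l2_bounded_integrable_inner[OF H2 noise_l2, of t i] unfolding eq .
    fix w
    interpret Di: prob_space "D i" using problem by (simp add: stochastic_problem_def)
    have int: "integrable (D i) (stoch_grad ft i x)" and mean: "grad i x = (\<integral>s. stoch_grad ft i x s \<partial>D i)" for x
      using problem by (auto simp: stochastic_problem_def)
    show "(\<integral>s. ?\<phi> (w, s) \<partial>D i) = 0"
      using int mean[of "Z (Suc t) w $ i"] Di.prob_space by simp
  qed
  then show ?thesis unfolding eq .
qed

text \<open>Each row is compressed with a seed independent of the past, so the contraction property of the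
  compressor holds in mean square for the random residual.\<close>

lemma compression_error_l2:
  assumes "l2_bounded M (\<lambda>w. X t w - Xh t w) b"
  shows "l2_bounded M (compression_error t) (sqrt (1 - \<omega>) * b)"
proof (rule l2_bounded_rows)
  note bD = l2_boundedD[OF assms]
  have XM: "X t \<in> borel_measurable M" "Xh (Suc t) \<in> borel_measurable M"
    using alg_measurable_M X_adapted Xh_adapted by blast+
  then show "compression_error t \<in> borel_measurable M" unfolding compression_error_def[abs_def] by measurable
  let ?e = "\<lambda>i w. X t w $ i - Xh t w $ i"
  have e_alg[measurable]: "?e i \<in> borel_measurable (alg (past t))" for i
    by (intro borel_measurable_diff borel_measurable_row X_adapted Xh_adapted)
  have [measurable]: "?e i \<in> borel_measurable M" for i by (rule alg_measurable_M[OF e_alg])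
  show "(\<integral>\<^sup>+w. ennreal ((norm (compression_error t w $ i))\<^sup>2) \<partial>M)
      \<le> ennreal (1 - \<omega>) * (\<integral>\<^sup>+w. ennreal ((norm ((X t w - Xh t w) $ i))\<^sup>2) \<partial>M)" for i
  proof -
    have [measurable]: "(\<lambda>p. Q (?e i (fst p)) (snd p) - ?e i (fst p)) \<in> borel_measurable (alg (past t) \<Otimes>\<^sub>M R)"
      by (intro borel_measurable_diff[of "\<lambda>p. Q (?e i (fst p)) (snd p)"] Q_compose
          measurable_compose[OF measurable_fst e_alg] measurable_snd)
    have "(\<integral>\<^sup>+w. ennreal ((norm (compression_error t w $ i))\<^sup>2) \<partial>M)
        = (\<integral>\<^sup>+w. (\<lambda>p. ennreal ((norm (Q (?e i (fst p)) (snd p) - ?e i (fst p)))\<^sup>2)) (w, \<rho> i t w) \<partial>M)"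
      by (intro nn_integral_cong) (simp add: compression_error_def iteration_step algebra_simps)
    also have "\<dots> = (\<integral>\<^sup>+w. \<integral>\<^sup>+r. ennreal ((norm (Q (?e i w) r - ?e i w))\<^sup>2) \<partial>R \<partial>M)"
      by (subst nn_integral_freeze[OF rho_fresh]) simp_all
    also have "\<dots> \<le> (\<integral>\<^sup>+w. ennreal ((1 - \<omega>) * (norm (?e i w))\<^sup>2) \<partial>M)"
      using compression by (intro nn_integral_mono) (auto simp: compression_operator_def)
    also have "\<dots> = ennreal (1 - \<omega>) * (\<integral>\<^sup>+w. ennreal ((norm (?e i w))\<^sup>2) \<partial>M)"
      using omega by (subst nn_integral_cmult[symmetric]) (auto simp: ennreal_mult)
    finally show ?thesis by simp
  qed
  have "(\<Sum>i\<in>UNIV. ennreal (1 - \<omega>) * (\<integral>\<^sup>+w. ennreal ((norm ((X t w - Xh t w) $ i))\<^sup>2) \<partial>M))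
      = ennreal (1 - \<omega>) * (\<integral>\<^sup>+w. ennreal ((norm (X t w - Xh t w))\<^sup>2) \<partial>M)"
    by (simp only: sum_distrib_left[symmetric] nn_integral_norm_sq_rows[OF bD(1)])
  also have "\<dots> \<le> ennreal (1 - \<omega>) * ennreal (b\<^sup>2)" by (intro mult_left_mono bD) simp
  also have "\<dots> = ennreal ((sqrt (1 - \<omega>) * b)\<^sup>2)"
    using omega by (simp add: ennreal_mult power_mult_distrib)
  finally show "(\<Sum>i\<in>UNIV. ennreal (1 - \<omega>) * (\<integral>\<^sup>+w. ennreal ((norm ((X t w - Xh t w) $ i))\<^sup>2) \<partial>M))
      \<le> ennreal ((sqrt (1 - \<omega>) * b)\<^sup>2)" .
  show "0 \<le> sqrt (1 - \<omega>) * b" using bD(2) omega by simp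
qed

lemma sampled_grad_l2: "l2_bounded M (sampled_grad (Suc t)) (\<bar>G\<bar> * sqrt (real CARD('n)))"
proof (rule l2_bounded_rows)
  show "sampled_grad (Suc t) \<in> borel_measurable M"
    by (rule borel_measurable_rows) (rule l2_boundedD[OF sampled_grad_row_l2])
  show "(\<integral>\<^sup>+w. ennreal ((norm (sampled_grad (Suc t) w $ i))\<^sup>2) \<partial>M) \<le> ennreal (\<bar>G\<bar>\<^sup>2)" for i
    by (rule l2_boundedD[OF sampled_grad_row_l2])
  show "(\<Sum>i\<in>(UNIV::'n set). ennreal (\<bar>G\<bar>\<^sup>2)) \<le> ennreal ((\<bar>G\<bar> * sqrt (real CARD('n)))\<^sup>2)"
    by (simp add: power_mult_distrib ennreal_mult' ennreal_of_nat_eq_real_of_nat mult.commute)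
qed simp

end

section \<open>Consensus\<close>

lemma outer_prod_ones_mult:
  fixes A :: "real^'d^'n"
  shows "(outer_prod \<phi> (vec 1) ** A) $ i = \<phi> $ i *\<^sub>R (\<Sum>j\<in>UNIV. A $ j)"
  by (simp add: outer_prod_def matrix_matrix_mult_def vec_eq_iff sum_distrib_left)

lemma matrix_row_eqI: "(\<And>i. A $ i = B $ i) \<Longrightarrow> (A :: 'a^'n) = B"
  by (simp add: vec_eq_iff)

context push_sum_sgd
begin

text \<open>The limit of the powers of \<open>W\<close>: it spreads the column sums over the agents according to \<open>\<phi>\<close>.\<close>

definition P :: "real^'n^'n" where "P = outer_prod \<phi> (vec 1)"

lemma P_mult_row: "(P ** (A :: real^'d^'n)) $ i = \<phi> $ i *\<^sub>R (\<Sum>j\<in>UNIV. A $ j)"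
  unfolding P_def by (rule outer_prod_ones_mult)

lemma column_sum: "(\<Sum>i\<in>UNIV. W $ i $ j) = 1"
proof -
  have "(vec 1 v* W) $ j = vec 1 $ j" by (simp only: column_stochastic)
  then show ?thesis by (simp add: vector_matrix_mult_def)
qed

lemma sum_rows_W_mult:
  fixes A :: "real^'d^'n"
  shows "(\<Sum>i\<in>UNIV. (W ** A) $ i) = (\<Sum>i\<in>UNIV. A $ i)"
proof (subst vec_eq_iff, rule allI)
  fix k
  have "(\<Sum>i\<in>UNIV. (W ** A) $ i) $ k = (\<Sum>i\<in>UNIV. \<Sum>j\<in>UNIV. W $ i $ j * A $ j $ k)"
    by (simp add: matrix_matrix_mult_def)
  also have "\<dots> = (\<Sum>j\<in>UNIV. \<Sum>i\<in>UNIV. W $ i $ j * A $ j $ k)" by (rule sum.swap)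
  finally show "(\<Sum>i\<in>UNIV. (W ** A) $ i) $ k = (\<Sum>i\<in>UNIV. A $ i) $ k"
    by (simp add: sum_distrib_right[symmetric] column_sum)
qed

lemma P_W: "P ** (W ** A) = P ** (A :: real^'d^'n)"
  by (rule matrix_row_eqI) (simp add: P_mult_row sum_rows_W_mult)

lemma W_P: "W ** (P ** A) = P ** (A :: real^'d^'n)"
proof -
  have "(\<Sum>j\<in>UNIV. W $ i $ j * \<phi> $ j) = \<phi> $ i" for i
    using phi_fixed by (simp add: vec_eq_iff matrix_vector_mult_def)
  then have "W ** P = P"
    by (simp add: vec_eq_iff matrix_matrix_mult_def outer_prod_def P_def)
  then show ?thesis by (simp add: matrix_mul_assoc)
qed

lemma damped_mixing:
  "norm (matrix_pow (damped \<gamma> W) k ** A - P ** A) \<le> C * (1 - \<gamma> * \<delta>) ^ k * norm (A :: real^'d^'n)"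
proof (rule damped_contraction)
  fix j and A :: "real^'d^'n"
  have "norm ((matrix_pow W j - P) ** A) \<le> spectral_norm (matrix_pow W j - P) * norm A"
    by (rule norm_matrix_mult_le)
  also have "\<dots> \<le> C * (1 - \<delta>) ^ j * norm A"
    unfolding P_def by (intro mult_right_mono ergodic) simp
  finally show "norm (matrix_pow W j ** A - P ** A) \<le> C * (1 - \<delta>) ^ j * norm A"
    by (simp add: matrix_diff_rdistrib)
qed (use gamma_range in auto)

lemma P_damped: "P ** (damped \<gamma> W ** A) = P ** (A :: real^'d^'n)"
  by (simp add: damped_def matrix_linear_simps P_W)

text \<open>If \<open>\<beta>\<close> were zero, the quotient defining \<open>\<gamma>\<close> would have the default value zero.\<close>

lemma beta_pos: "0 < \<beta>"
proof -
  have "0 \<le> \<beta>" by (simp add: beta spectral_norm_nonneg)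
  moreover have "\<beta> \<noteq> 0" using gamma gamma_range(1) by auto
  ultimately show ?thesis by simp
qed

text \<open>What the compression error adds to one round of damped mixing.\<close>

definition perturbation :: "nat \<Rightarrow> 'w \<Rightarrow> real^'d^'n" where
  "perturbation t w = \<gamma> *\<^sub>R ((W - mat 1) ** compression_error t w)"

lemma U_Suc_eq:
  assumes "w \<in> space M"
  shows "U (Suc t) w = damped \<gamma> W ** X t w + perturbation t w"
  using iteration_step(2)[OF assms]
  by (simp add: damped_def perturbation_def compression_error_def matrix_linear_simps) (simp add: algebra_simps)

lemma X_Suc_eq:
  assumes "w \<in> space M"
  shows "X (Suc t) w = U (Suc t) w - \<eta> *\<^sub>R sampled_grad (Suc t) w"
  by (rule matrix_row_eqI) (simp add: iteration_step(4)[OF assms] sampled_grad_def)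

text \<open>Since \<open>W - I\<close> annihilates \<open>P\<close>, the residual is fed by the distance to consensus, not by the
  iterate itself.\<close>

lemma compression_residual_Suc:
  assumes "w \<in> space M"
  shows "X (Suc t) w - Xh (Suc t) w
    = perturbation t w - compression_error t w + \<gamma> *\<^sub>R ((W - mat 1) ** (X t w - P ** X t w)) - \<eta> *\<^sub>R sampled_grad (Suc t) w"
  by (simp add: X_Suc_eq[OF assms] U_Suc_eq[OF assms] damped_def compression_error_def matrix_linear_simps W_P)
    (simp add: algebra_simps)

text \<open>The size in \<open>L\<^sup>2\<close> of one gradient step of all agents together.\<close>

definition noise_level :: real where "noise_level = \<eta> * (\<bar>G\<bar> * sqrt (real CARD('n)))"

text \<open>The stationary value of the linear recursion in \<open>residual_bound_recursion\<close>, solved for equality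
  with the gain of the recursion estimated by \<open>1 - \<omega> / 3\<close>.\<close>

definition residual_bound :: real where
  "residual_bound = 3 * (1 + C * \<beta> / \<delta>) * noise_level / \<omega>"

text \<open>The total disturbance of damped mixing in one round: compression and gradient step.\<close>

definition drift_bound :: real where "drift_bound = \<gamma> * \<beta> * residual_bound + noise_level"

lemma noise_level_nonneg: "0 \<le> noise_level"
  using stepsize by (simp add: noise_level_def)

lemma residual_bound_nonneg: "0 \<le> residual_bound"
  using noise_level_nonneg C_pos beta_pos delta omega by (simp add: residual_bound_def)

lemma gamma_beta: "\<gamma> * \<beta> = \<omega> * \<delta> / (12 * (\<beta> + 1) * (C + 1))"
  using beta_pos by (simp add: gamma)

text \<open>The choice of \<open>\<gamma>\<close> makes the feedback from consensus error to
  compression residual small compared with the compression quality \<open>\<omega>\<close>.\<close>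

lemma gamma_beta_le: "12 * (\<gamma> * \<beta> * (\<delta> + C * \<beta>)) \<le> \<omega> * \<delta>"
proof -
  define q where "q = (\<beta> + 1) * (C + 1)"
  have q: "0 < q" using beta_pos C_pos by (simp add: q_def)
  have "\<delta> + C * \<beta> \<le> q"
    using delta beta_pos C_pos by (simp add: q_def algebra_simps)
  then have "\<omega> * \<delta> * (\<delta> + C * \<beta>) \<le> \<omega> * \<delta> * q"
    using omega delta by (intro mult_left_mono) auto
  moreover have "12 * (\<gamma> * \<beta> * (\<delta> + C * \<beta>)) = \<omega> * \<delta> * (\<delta> + C * \<beta>) / q"
  proof -
    have "\<gamma> * \<beta> = \<omega> * \<delta> / (12 * q)" by (simp only: gamma_beta q_def mult.assoc)
    then show ?thesis by simp
  qed
  ultimately show ?thesis using q by (simp add: divide_le_eq)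
qed

lemma drift_bound_le: "drift_bound \<le> 5 / 4 * noise_level"
proof -
  have "\<gamma> * \<beta> * residual_bound = 12 * (\<gamma> * \<beta> * (\<delta> + C * \<beta>)) / (\<omega> * \<delta>) * (noise_level / 4)"
    using omega delta by (simp add: residual_bound_def field_simps)
  also have "\<dots> \<le> 1 * (noise_level / 4)"
    using gamma_beta_le omega delta noise_level_nonneg
    by (intro mult_right_mono) (auto simp: divide_le_eq)
  finally show ?thesis by (simp add: drift_bound_def)
qed

lemma drift_bound_nonneg: "0 \<le> drift_bound"
  using noise_level_nonneg residual_bound_nonneg gamma_range beta_pos by (simp add: drift_bound_def)

lemma sqrt_one_minus_le: "sqrt (1 - \<omega>) \<le> 1 - \<omega> / 2"
  using omega by (intro real_le_lsqrt) (auto simp: power2_eq_square algebra_simps)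

lemma compressed_residual_le: "sqrt (1 - \<omega>) * residual_bound \<le> residual_bound"
  using sqrt_one_minus_le omega residual_bound_nonneg mult_right_mono[of "sqrt (1 - \<omega>)" 1 residual_bound]
  by simp

text \<open>Compression shrinks the residual by \<open>1 - \<omega> / 2\<close>. The two feedback terms, through the perturbation
  and through the consensus error, cost at most \<open>\<omega> / 12\<close> each, which leaves a factor
  \<open>1 - \<omega> / 3\<close> to absorb the gradient step.\<close>

lemma residual_bound_recursion:
  "(1 + \<gamma> * \<beta>) * (sqrt (1 - \<omega>) * residual_bound) + \<gamma> * \<beta> * (C * drift_bound / (\<gamma> * \<delta>)) + noise_level
    \<le> residual_bound"
proof -
  let ?p = "\<gamma> * \<beta>"
  have "0 < ?p" using gamma_range beta_pos by simp
  have p1: "?p \<le> \<omega> / 12"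
  proof -
    have "?p * \<delta> \<le> ?p * (\<delta> + C * \<beta>)"
      using \<open>0 < ?p\<close> C_pos beta_pos by (intro mult_left_mono) auto
    with gamma_beta_le have "12 * ?p * \<delta> \<le> \<omega> * \<delta>" by linarith
    then show ?thesis using delta by simp
  qed
  have p2: "C * \<beta> / \<delta> * ?p \<le> \<omega> / 12"
  proof -
    have "?p * (C * \<beta>) \<le> ?p * (\<delta> + C * \<beta>)"
      using \<open>0 < ?p\<close> delta by (intro mult_left_mono) auto
    with gamma_beta_le have "12 * (?p * (C * \<beta>)) \<le> \<omega> * \<delta>" by linarith
    then show ?thesis using delta by (simp add: field_simps)
  qed
  have "(1 + ?p) * sqrt (1 - \<omega>) \<le> (1 + \<omega> / 12) * (1 - \<omega> / 2)"
    using p1 sqrt_one_minus_le omega \<open>0 < ?p\<close> by (intro mult_mono) auto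
  also have "\<dots> \<le> 1 - 5 * \<omega> / 12" using omega by (simp add: algebra_simps)
  finally have "(1 + ?p) * sqrt (1 - \<omega>) * residual_bound \<le> (1 - 5 * \<omega> / 12) * residual_bound"
    by (rule mult_right_mono) (rule residual_bound_nonneg)
  then have 1: "(1 + ?p) * (sqrt (1 - \<omega>) * residual_bound)
      \<le> residual_bound - 5 / 12 * (\<omega> * residual_bound)"
    by (simp add: algebra_simps)
  have "?p * (C * drift_bound / (\<gamma> * \<delta>)) = C * \<beta> / \<delta> * drift_bound"
    using gamma_range by simp
  also have "\<dots> = (C * \<beta> / \<delta> * ?p) * residual_bound + C * \<beta> / \<delta> * noise_level"
    by (simp add: drift_bound_def distrib_left)
  also have "(C * \<beta> / \<delta> * ?p) * residual_bound \<le> \<omega> / 12 * residual_bound"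
    by (rule mult_right_mono[OF p2 residual_bound_nonneg])
  finally have 2: "?p * (C * drift_bound / (\<gamma> * \<delta>))
      \<le> 1 / 12 * (\<omega> * residual_bound) + C * \<beta> / \<delta> * noise_level" by simp
  have "noise_level + C * \<beta> / \<delta> * noise_level = 1 / 3 * (\<omega> * residual_bound)"
    using omega by (simp add: residual_bound_def distrib_right)
  with 1 2 show ?thesis by linarith
qed

lemma perturbation_l2:
  assumes "l2_bounded M (compression_error t) b"
  shows "l2_bounded M (perturbation t) (\<gamma> * \<beta> * b)"
proof -
  have "l2_bounded M (\<lambda>w. (W - mat 1) ** compression_error t w) (\<beta> * b)"
    using norm_matrix_mult_le[of "W - mat 1"] beta_pos unfolding beta
    by (intro l2_bounded_matrix_mult[OF assms]) (auto simp: spectral_norm_nonneg)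
  from l2_bounded_scaleR[OF this, of \<gamma>] show ?thesis
    using gamma_range by (simp add: perturbation_def[abs_def] mult.assoc)
qed

lemma mixing_rate_nonneg: "0 \<le> 1 - \<gamma> * \<delta>"
  using gamma_range delta mult_mono[of \<gamma> 1 \<delta> 1] by simp

lemma mixing_deviation_l2:
  fixes f :: "'w \<Rightarrow> real^'d^'n"
  assumes "l2_bounded M f b"
  shows "l2_bounded M (\<lambda>w. matrix_pow (damped \<gamma> W) k ** f w - P ** f w) (C * (1 - \<gamma> * \<delta>) ^ k * b)"
proof -
  have "l2_bounded M (\<lambda>w. (matrix_pow (damped \<gamma> W) k - P) ** f w) (C * (1 - \<gamma> * \<delta>) ^ k * b)"
    using damped_mixing[of k] C_pos mixing_rate_nonneg
    by (intro l2_bounded_matrix_mult[OF assms, where c="C * (1 - \<gamma> * \<delta>) ^ k"])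
      (auto simp: matrix_diff_rdistrib)
  then show ?thesis by (simp add: matrix_diff_rdistrib)
qed

text \<open>The disturbance summed over the geometric series of damped mixing.\<close>

definition consensus_bound :: real where "consensus_bound = C * drift_bound / (\<gamma> * \<delta>)"

lemma consensus_bound_recursion:
  "consensus_bound * (1 - \<gamma> * \<delta>) ^ Suc k + C * (1 - \<gamma> * \<delta>) ^ k * drift_bound
    = consensus_bound * (1 - \<gamma> * \<delta>) ^ k"
  using gamma_range delta by (simp add: consensus_bound_def field_simps)

lemma step_noise_l2: "l2_bounded M (\<lambda>w. \<eta> *\<^sub>R sampled_grad (Suc t) w) noise_level"
  using l2_bounded_scaleR[OF sampled_grad_l2, of \<eta> t] stepsize by (simp add: noise_level_def)

text \<open>Both errors have to be bounded together, because each feeds the other. The mixing estimate has a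
  constant \<open>C\<close> that may exceed one, so the consensus error cannot be propagated by a one-step
  contraction. The invariant instead bounds the deviation after \<open>k\<close> further rounds of
  undisturbed mixing, for every \<open>k\<close>; one step of the algorithm trades one such round for one new
  disturbance, and the constant is paid only once per disturbance.\<close>

lemma consensus_invariant:
  "l2_bounded M (\<lambda>w. X t w - Xh t w) residual_bound \<and>
   (\<forall>k. l2_bounded M (\<lambda>w. matrix_pow (damped \<gamma> W) k ** X t w - P ** X t w)
      (consensus_bound * (1 - \<gamma> * \<delta>) ^ k))"
proof (induction t)
  case 0
  have cb: "0 \<le> consensus_bound"
    using drift_bound_nonneg C_pos gamma_range delta by (simp add: consensus_bound_def)
  have z: "l2_bounded M (\<lambda>w. 0 :: real^'d^'n) b" if "0 \<le> b" for b
    using l2_bounded_weaken[OF l2_bounded_zero that] .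
  have mz: "A ** (0 :: real^'d^'n) = 0" for A :: "real^'n^'n"
    by (simp add: vec_eq_iff matrix_matrix_mult_def)
  show ?case
    using mixing_rate_nonneg cb residual_bound_nonneg
    by (auto intro!: l2_bounded_cong[OF z] simp: init mz)
next
  case (Suc t)
  let ?Dm = "matrix_pow (damped \<gamma> W)"
  from Suc have res: "l2_bounded M (\<lambda>w. X t w - Xh t w) residual_bound"
    and con: "\<And>k. l2_bounded M (\<lambda>w. ?Dm k ** X t w - P ** X t w) (consensus_bound * (1 - \<gamma> * \<delta>) ^ k)"
    by auto
  let ?r = "sqrt (1 - \<omega>) * residual_bound"
  note ce = compression_error_l2[OF res]
  note pe = perturbation_l2[OF ce]
  have "l2_bounded M (\<lambda>w. \<gamma> *\<^sub>R ((W - mat 1) ** (X t w - P ** X t w))) (\<gamma> * (\<beta> * consensus_bound))"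
  proof -
    have "l2_bounded M (\<lambda>w. X t w - P ** X t w) consensus_bound"
      using con[of 0] by simp
    then have "l2_bounded M (\<lambda>w. (W - mat 1) ** (X t w - P ** X t w)) (\<beta> * consensus_bound)"
      using norm_matrix_mult_le[of "W - mat 1"] unfolding beta
      by (rule l2_bounded_matrix_mult) (auto simp: spectral_norm_nonneg)
    from l2_bounded_scaleR[OF this, of \<gamma>] show ?thesis using gamma_range by simp
  qed
  from l2_bounded_diff[OF l2_bounded_add[OF l2_bounded_diff[OF pe ce] this] step_noise_l2[of t]]
  have "l2_bounded M (\<lambda>w. X (Suc t) w - Xh (Suc t) w)
      (\<gamma> * \<beta> * ?r + ?r + \<gamma> * (\<beta> * consensus_bound) + noise_level)"
    by (rule l2_bounded_cong) (simp add: compression_residual_Suc)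
  then have 1: "l2_bounded M (\<lambda>w. X (Suc t) w - Xh (Suc t) w) residual_bound"
    using residual_bound_recursion
    by (elim l2_bounded_weaken) (simp add: consensus_bound_def algebra_simps)
  have pe': "l2_bounded M (perturbation t) (\<gamma> * \<beta> * residual_bound)"
    by (rule perturbation_l2[OF l2_bounded_weaken[OF ce compressed_residual_le]])
  have drift: "l2_bounded M (\<lambda>w. perturbation t w - \<eta> *\<^sub>R sampled_grad (Suc t) w) drift_bound"
    using l2_bounded_diff[OF pe' step_noise_l2] by (simp add: drift_bound_def)
  have 2: "l2_bounded M (\<lambda>w. ?Dm k ** X (Suc t) w - P ** X (Suc t) w)
      (consensus_bound * (1 - \<gamma> * \<delta>) ^ k)" for k
    using l2_bounded_add[OF con[of "Suc k"] mixing_deviation_l2[OF drift, of k]]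
    unfolding consensus_bound_recursion
    by (rule l2_bounded_cong)
      (simp add: X_Suc_eq U_Suc_eq matrix_pow_Suc_right matrix_linear_simps P_damped
        matrix_mul_assoc[symmetric] del: matrix_pow.simps)
  from 1 2 show ?case by blast
qed

text \<open>The gradient step of the current round is not yet part of \<open>U\<close>, so the disturbance is just the
  perturbation and the same bound applies.\<close>

lemma U_consensus:
  "l2_bounded M (\<lambda>w. U (Suc t) w - P ** U (Suc t) w) consensus_bound"
proof -
  from consensus_invariant[of t]
  have res: "l2_bounded M (\<lambda>w. X t w - Xh t w) residual_bound"
    and con: "l2_bounded M (\<lambda>w. matrix_pow (damped \<gamma> W) 1 ** X t w - P ** X t w) (consensus_bound * (1 - \<gamma> * \<delta>) ^ 1)"
    by blast+
  have "l2_bounded M (perturbation t) (\<gamma> * \<beta> * residual_bound)"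
    by (rule perturbation_l2[OF l2_bounded_weaken[OF compression_error_l2[OF res] compressed_residual_le]])
  then have "l2_bounded M (perturbation t) drift_bound"
    by (rule l2_bounded_weaken) (simp add: drift_bound_def noise_level_nonneg)
  from l2_bounded_add[OF con mixing_deviation_l2[OF this, of 0]]
  have "l2_bounded M (\<lambda>w. U (Suc t) w - P ** U (Suc t) w)
      (consensus_bound * (1 - \<gamma> * \<delta>) ^ 1 + C * (1 - \<gamma> * \<delta>) ^ 0 * drift_bound)"
    by (rule l2_bounded_cong) (simp add: U_Suc_eq matrix_linear_simps P_damped)
  then show ?thesis using consensus_bound_recursion[of 0] by simp
qed

definition xbar :: "nat \<Rightarrow> 'w \<Rightarrow> real^'d" where
  "xbar t w = (1 / real CARD('n)) *\<^sub>R (\<Sum>i\<in>UNIV. X t w $ i)"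

lemma sum_rows_U: 
  assumes "w \<in> space M"
  shows "(\<Sum>i\<in>UNIV. U (Suc t) w $ i) = real CARD('n) *\<^sub>R xbar t w"
proof -
  have "(\<Sum>i\<in>UNIV. ((W - mat 1) ** A) $ i) = 0" for A :: "real^'d^'n"
    using sum_rows_W_mult[of A] by (simp add: matrix_diff_rdistrib sum_subtractf)
  then show ?thesis
    by (simp add: iteration_step(2)[OF assms] sum.distrib scaleR_sum_right[symmetric] xbar_def)
qed

text \<open>Mixing and compression preserve the average, so the average performs stochastic gradient descent
  with gradients at the points \<open>z\<^sub>i\<close>.\<close>

lemma xbar_Suc:
  assumes "w \<in> space M"
  shows "xbar (Suc t) w = xbar t w - (\<eta> / real CARD('n)) *\<^sub>R (\<Sum>i\<in>UNIV. sampled_grad (Suc t) w $ i)"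
proof -
  have "(\<Sum>i\<in>UNIV. X (Suc t) w $ i) = real CARD('n) *\<^sub>R xbar t w - \<eta> *\<^sub>R (\<Sum>i\<in>UNIV. sampled_grad (Suc t) w $ i)"
    by (simp add: X_Suc_eq[OF assms] sum_subtractf sum_rows_U[OF assms] scaleR_sum_right)
  then show ?thesis
    by (simp add: xbar_def[of "Suc t"] scaleR_diff_right)
qed

lemma xbar_l2: "l2_bounded M (xbar t) (real t * (\<eta> * \<bar>G\<bar>))"
proof (induction t)
  case 0
  have "l2_bounded M (xbar 0) 0"
    by (rule l2_bounded_cong[OF l2_bounded_zero]) (simp add: xbar_def init)
  then show ?case by simp
next
  case (Suc t)
  have "l2_bounded M (\<lambda>w. \<Sum>i\<in>UNIV. sampled_grad (Suc t) w $ i) (\<Sum>i\<in>(UNIV::'n set). \<bar>G\<bar>)"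
    by (intro l2_bounded_sum sampled_grad_row_l2) simp
  from l2_bounded_diff[OF Suc l2_bounded_scaleR[OF this, of "\<eta> / real CARD('n)"]]
  have "l2_bounded M (xbar (Suc t)) (real t * (\<eta> * \<bar>G\<bar>) + \<bar>\<eta> / real CARD('n)\<bar> * (\<Sum>i\<in>(UNIV::'n set). \<bar>G\<bar>))"
    by (rule l2_bounded_cong) (simp add: xbar_Suc)
  then show ?case using stepsize by (simp add: algebra_simps)
qed

text \<open>Bernoulli's inequality for \<open>(1 + \<delta>)^t\<close> together with \<open>(1 - \<delta>) (1 + \<delta>) \<le> 1\<close>.\<close>

lemma decay_times_le: "(1 - \<delta>) ^ Suc t * real t \<le> 1 / \<delta>"
proof -
  have d: "0 \<le> 1 - \<delta>" "1 - \<delta> \<le> 1" using delta by auto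
  have "(1 - \<delta>) ^ t * (1 + real t * \<delta>) \<le> (1 - \<delta>) ^ t * (1 + \<delta>) ^ t"
    using d delta Bernoulli_inequality[of \<delta> t] by (intro mult_left_mono) auto
  also have "\<dots> = (1 - \<delta>\<^sup>2) ^ t"
    by (simp add: power_mult_distrib[symmetric] algebra_simps power2_eq_square)
  also have "\<dots> \<le> 1"
    using delta by (intro power_le_one) (auto simp: power_le_one)
  finally have "(1 - \<delta>) ^ t * (real t * \<delta>) \<le> 1"
    using zero_le_power[OF d(1), of t] unfolding distrib_left by linarith
  moreover have "(1 - \<delta>) ^ Suc t * (real t * \<delta>) \<le> (1 - \<delta>) ^ t * (real t * \<delta>)"
    using d delta by (intro mult_right_mono power_decreasing) auto
  ultimately have "(1 - \<delta>) ^ Suc t * (real t * \<delta>) \<le> 1" by linarith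
  then show ?thesis using delta by (simp only: pos_le_divide_eq mult.assoc)
qed

text \<open>The first term is the distance of \<open>U\<close> from consensus; the second is due to the push-sum weights,
  which have not converged yet.\<close>

definition deviation_bound :: real where
  "deviation_bound = (consensus_bound + C * noise_level / \<delta>) / \<kappa>"

text \<open>The numerator \<open>u\<^sub>i - y\<^sub>i xbar\<close> of the deviation splits into the consensus error of \<open>U\<close>, whose
  consensus limit is \<open>n \<phi> xbar\<close>, and the error of the weights \<open>y\<close>, which tend to \<open>n \<phi>\<close>. The weight error
  decays geometrically while \<open>xbar\<close> grows at most linearly, so their product stays bounded. The
  denominator is at least \<open>\<kappa>\<close>.\<close>

lemma push_sum_ratio_l2:
  "l2_bounded M (\<lambda>w. (\<chi> i. Z (Suc t) w $ i - xbar t w) :: real^'d^'n) deviation_bound"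
proof -
  let ?v = "real CARD('n) *\<^sub>R \<phi> - y (Suc t)"
  have v: "norm ?v \<le> C * (1 - \<delta>) ^ Suc t * sqrt (real CARD('n))"
  proof -
    have "P *v vec 1 = real CARD('n) *\<^sub>R \<phi>"
      by (simp add: P_def outer_prod_def matrix_vector_mult_def vec_eq_iff)
    then have "?v = - ((matrix_pow W (Suc t) - P) *v vec 1)"
      by (simp add: y_eq matrix_vector_mult_diff_rdistrib del: matrix_pow.simps)
    then have "norm ?v \<le> spectral_norm (matrix_pow W (Suc t) - P) * norm (vec 1 :: real^'n)"
      using norm_matrix_vector_le[of "matrix_pow W (Suc t) - P" "vec 1"] by (simp del: matrix_pow.simps)
    also have "norm (vec 1 :: real^'n) = sqrt (real CARD('n))"
      by (simp add: norm_vec_def L2_set_def)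
    also have "spectral_norm (matrix_pow W (Suc t) - P) * sqrt (real CARD('n)) \<le> C * (1 - \<delta>) ^ Suc t * sqrt (real CARD('n))"
      unfolding P_def by (intro mult_right_mono ergodic) simp
    finally show ?thesis .
  qed
  have "l2_bounded M (\<lambda>w. (\<chi> i. ?v $ i *\<^sub>R xbar t w) :: real^'d^'n) (C * noise_level / \<delta>)"
  proof (rule l2_bounded_dominated[OF xbar_l2, where c="norm ?v"])
    show "(\<lambda>w. (\<chi> i. ?v $ i *\<^sub>R xbar t w) :: real^'d^'n) \<in> borel_measurable M"
      using l2_boundedD(1)[OF xbar_l2[of t]] by - (rule borel_measurable_rows, simp)
    show "norm ((\<chi> i. ?v $ i *\<^sub>R xbar t w) :: real^'d^'n) \<le> norm ?v * norm (xbar t w)" for w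
    proof (rule power2_le_imp_le)
      have "(norm ?v)\<^sup>2 = (\<Sum>i\<in>UNIV. (?v $ i)\<^sup>2)"
        by (simp only: norm_vec_def L2_set_def) (simp add: sum_nonneg)
      then show "(norm ((\<chi> i. ?v $ i *\<^sub>R xbar t w) :: real^'d^'n))\<^sup>2 \<le> (norm ?v * norm (xbar t w))\<^sup>2"
        by (simp add: norm_matrix_sq_rows power_mult_distrib sum_distrib_right
            del: vector_minus_component)
    qed simp
    have "norm ?v * (real t * (\<eta> * \<bar>G\<bar>)) \<le> C * (1 - \<delta>) ^ Suc t * sqrt (real CARD('n)) * (real t * (\<eta> * \<bar>G\<bar>))"
      using stepsize by (intro mult_right_mono v) auto
    also have "\<dots> = C * noise_level * ((1 - \<delta>) ^ Suc t * real t)"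
      by (simp add: noise_level_def mult_ac)
    also have "\<dots> \<le> C * noise_level * (1 / \<delta>)"
      using C_pos noise_level_nonneg by (intro mult_left_mono decay_times_le) auto
    finally show "norm ?v * (real t * (\<eta> * \<bar>G\<bar>)) \<le> C * noise_level / \<delta>" by simp
  qed simp
  from l2_bounded_add[OF U_consensus[of t] this]
  have V: "l2_bounded M (\<lambda>w. \<chi> i. U (Suc t) w $ i - y (Suc t) $ i *\<^sub>R xbar t w)
      (consensus_bound + C * noise_level / \<delta>)"
    by (rule l2_bounded_cong)
      (rule matrix_row_eqI, simp add: P_mult_row sum_rows_U algebra_simps)
  show ?thesis
  proof (rule l2_bounded_dominated[OF V, where c="1 / \<kappa>"])
    have "(\<lambda>w. Z (Suc t) w $ i) \<in> borel_measurable M" for i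
      by (rule alg_measurable_M[OF Z_others])
    then show "(\<lambda>w. (\<chi> i. Z (Suc t) w $ i - xbar t w) :: real^'d^'n) \<in> borel_measurable M"
      using l2_boundedD(1)[OF xbar_l2[of t]] by - (rule borel_measurable_rows, simp)
    fix w assume w: "w \<in> space M"
    show "norm ((\<chi> i. Z (Suc t) w $ i - xbar t w) :: real^'d^'n)
      \<le> 1 / \<kappa> * norm (\<chi> i. U (Suc t) w $ i - y (Suc t) $ i *\<^sub>R xbar t w)"
    proof (rule power2_le_imp_le)
      have row: "norm (Z (Suc t) w $ i - xbar t w)
          \<le> 1 / \<kappa> * norm (U (Suc t) w $ i - y (Suc t) $ i *\<^sub>R xbar t w)" for i
      proof -
        have y: "\<kappa> \<le> y (Suc t) $ i" using kappa by (simp add: y_eq del: matrix_pow.simps)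
        with kappa_pos have "0 < y (Suc t) $ i" by simp
        then have "Z (Suc t) w $ i - xbar t w
            = (U (Suc t) w $ i - y (Suc t) $ i *\<^sub>R xbar t w) /\<^sub>R (y (Suc t) $ i)"
          by (simp add: iteration_step(3)[OF w] scaleR_diff_right)
        also have "norm \<dots> = 1 / y (Suc t) $ i * norm (U (Suc t) w $ i - y (Suc t) $ i *\<^sub>R xbar t w)"
          using \<open>0 < y (Suc t) $ i\<close> by (simp add: divide_simps)
        also have "\<dots> \<le> 1 / \<kappa> * norm (U (Suc t) w $ i - y (Suc t) $ i *\<^sub>R xbar t w)"
          using y kappa_pos by (intro mult_right_mono divide_left_mono) auto
        finally show ?thesis .
      qed
      have "(\<Sum>i\<in>UNIV. (norm (Z (Suc t) w $ i - xbar t w))\<^sup>2)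
          \<le> (\<Sum>i\<in>UNIV. (1 / \<kappa> * norm (U (Suc t) w $ i - y (Suc t) $ i *\<^sub>R xbar t w))\<^sup>2)"
        by (intro sum_mono power_mono row) simp
      then show "(norm ((\<chi> i. Z (Suc t) w $ i - xbar t w) :: real^'d^'n))\<^sup>2
        \<le> (1 / \<kappa> * norm (\<chi> i. U (Suc t) w $ i - y (Suc t) $ i *\<^sub>R xbar t w))\<^sup>2"
        by (simp add: norm_matrix_sq_rows power_divide sum_divide_distrib)
    qed (use kappa_pos in simp)
  qed (use kappa_pos in \<open>auto simp: deviation_bound_def\<close>)
qed

lemma deviation_bound_nonneg: "0 \<le> deviation_bound"
  using drift_bound_nonneg noise_level_nonneg C_pos gamma_range delta kappa_pos
  by (simp add: deviation_bound_def consensus_bound_def)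

text \<open>The factor 27 is 15 from the consensus error (5/4 times the 12 in \<open>\<gamma>\<close>) plus 12 from the weights,
  where \<open>\<gamma> \<le> 1\<close> bounds \<open>1 / \<delta>\<close> by the leading expression.\<close>

lemma deviation_bound_le:
  "deviation_bound \<le> 27 * C * (C + 1) * \<beta> * (\<beta> + 1) * noise_level / (\<omega> * \<delta>\<^sup>2 * \<kappa>)"
proof -
  define K where "K = (C + 1) * \<beta> * (\<beta> + 1)"
  have K: "0 < K" using C_pos beta_pos by (simp add: K_def)
  have g: "\<gamma> = \<omega> * \<delta> / (12 * K)" by (simp add: gamma K_def mult_ac)
  define q where "q = C * K * noise_level / (\<omega> * \<delta>\<^sup>2)"
  have "consensus_bound \<le> C * (5 / 4 * noise_level) / (\<gamma> * \<delta>)"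
    unfolding consensus_bound_def using C_pos gamma_range delta
    by (intro divide_right_mono mult_left_mono drift_bound_le) auto
  also have "\<dots> = 15 * q"
    using K omega delta by (simp add: g q_def power2_eq_square field_simps)
  finally have 1: "consensus_bound \<le> 15 * q" .
  have "1 / \<delta> \<le> 12 * K / (\<omega> * \<delta>\<^sup>2)"
  proof -
    have "\<omega> * \<delta> \<le> 12 * K" using gamma_range(2) K by (simp add: g)
    then show ?thesis using omega delta by (simp add: field_simps power2_eq_square)
  qed
  then have "C * noise_level * (1 / \<delta>) \<le> C * noise_level * (12 * K / (\<omega> * \<delta>\<^sup>2))"
    using C_pos noise_level_nonneg by (intro mult_left_mono) auto
  then have "C * noise_level / \<delta> \<le> 12 * q" by (simp add: q_def mult_ac)
  with 1 have "consensus_bound + C * noise_level / \<delta> \<le> 27 * C * K * noise_level / (\<omega> * \<delta>\<^sup>2)"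
    by (simp add: q_def mult.assoc)
  then have "deviation_bound \<le> 27 * C * K * noise_level / (\<omega> * \<delta>\<^sup>2) / \<kappa>"
    unfolding deviation_bound_def using kappa_pos by (intro divide_right_mono) auto
  then show ?thesis by (simp only: K_def mult_ac divide_divide_eq_left)
qed

end

section \<open>Convergence\<close>

context push_sum_sgd
begin

lemma global_loss_measurable: "global_loss D ft \<in> borel_measurable borel"
proof -
  have "local_loss D ft i \<in> borel_measurable borel" for i
    using problem
    by (intro borel_measurable_continuous_onI differentiable_imp_continuous_on)
      (auto simp: differentiable_on_def stochastic_problem_def differentiable_at_withinI)
  then show ?thesis unfolding global_loss_def[abs_def] by measurable
qed

text \<open>Smoothness at the minimizer bounds the optimality gap by the squared distance to \<open>xstar\<close>.\<close>

lemma integrable_global_loss: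
  assumes "l2_bounded M V a"
  shows "integrable M (\<lambda>w. global_loss D ft (V w))"
proof -
  have V: "l2_bounded M (\<lambda>w. V w - xstar) (a + norm xstar)"
    by (rule l2_bounded_diff[OF assms l2_bounded_const[OF prob_space_axioms]])
  have "integrable M (\<lambda>w. global_loss D ft (V w) - global_loss D ft xstar)"
  proof (rule Bochner_Integration.integrable_bound)
    show "integrable M (\<lambda>w. L / 2 * (norm (V w - xstar))\<^sup>2)"
      by (intro integrable_mult_right l2_bounded_integrable_norm_sq[OF V])
    have "(\<lambda>w. global_loss D ft (V w)) \<in> borel_measurable M"
      by (rule measurable_compose[OF l2_boundedD(1)[OF assms] global_loss_measurable])
    then show "(\<lambda>w. global_loss D ft (V w) - global_loss D ft xstar) \<in> borel_measurable M"
      by measurable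
    show "AE w in M. norm (global_loss D ft (V w) - global_loss D ft xstar)
        \<le> norm (L / 2 * (norm (V w - xstar))\<^sup>2)"
      using loss.gap_at_minimizer loss.minimal L_pos by auto
  qed
  from Bochner_Integration.integrable_add[OF this integrable_const[of "global_loss D ft xstar"]]
  show ?thesis by simp
qed

definition gap :: "nat \<Rightarrow> real" where
  "gap t = (\<integral>w. global_loss D ft (xbar t w) \<partial>M) - global_loss D ft xstar"

definition distance_sq :: "nat \<Rightarrow> real" where
  "distance_sq t = (\<integral>w. (norm (xbar t w - xstar))\<^sup>2 \<partial>M)"

lemma xbar_diff_l2: "l2_bounded M (\<lambda>w. xbar t w - xstar) (real t * (\<eta> * \<bar>G\<bar>) + norm xstar)"
  by (rule l2_bounded_diff[OF xbar_l2 l2_bounded_const[OF prob_space_axioms]])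

text \<open>The displacement from \<open>xstar\<close> after a step with the exact gradients at the points \<open>z\<^sub>i\<close>.\<close>

definition mean_step :: "nat \<Rightarrow> 'w \<Rightarrow> real^'d" where
  "mean_step t w = xbar t w - xstar - (\<eta> / real CARD('n)) *\<^sub>R (\<Sum>i\<in>UNIV. grad i (Z (Suc t) w $ i))"

lemma mean_step_others: "mean_step t \<in> borel_measurable (alg (others t i))"
proof -
  have "past t \<subseteq> others t i" using past_sent sent_others by blast
  then have [measurable]: "(\<lambda>w. X t w $ j) \<in> borel_measurable (alg (others t i))" for j
    by (intro borel_measurable_row alg_mono[OF X_adapted])
  have [measurable]: "(\<lambda>w. grad j (Z (Suc t) w $ j)) \<in> borel_measurable (alg (others t i))" for j
    by (rule measurable_compose[OF Z_others grad_measurable])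
  show ?thesis unfolding mean_step_def[abs_def] xbar_def by measurable
qed

lemma mean_step_l2: "\<exists>a. l2_bounded M (mean_step t) a"
proof -
  have "l2_bounded M (\<lambda>w. \<Sum>i\<in>UNIV. sampled_grad (Suc t) w $ i - noise (Suc t) i w) (\<Sum>i\<in>(UNIV::'n set). \<bar>G\<bar> + \<bar>\<sigma>\<bar>)"
    by (intro l2_bounded_sum l2_bounded_diff sampled_grad_row_l2 noise_l2) simp
  from l2_bounded_diff[OF xbar_diff_l2[of t] l2_bounded_scaleR[OF this, of "\<eta> / real CARD('n)"]]
  show ?thesis by (auto simp: mean_step_def[abs_def] noise_def)
qed

lemma mean_step_le:
  "(norm (mean_step t w))\<^sup>2
    \<le> (norm (xbar t w - xstar))\<^sup>2 - \<eta> * (global_loss D ft (xbar t w) - global_loss D ft xstar)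
      + 3 * \<eta> * L / (2 * real CARD('n)) * (norm ((\<chi> i. Z (Suc t) w $ i - xbar t w) :: real^'d^'n))\<^sup>2"
  using loss.perturbed_step[of \<eta> "xbar t w" "\<lambda>i. Z (Suc t) w $ i"] stepsize
  by (simp add: mean_step_def norm_matrix_sq_rows)

lemma noise_cross_zero:
  assumes "i \<noteq> j"
  shows "(\<integral>w. noise (Suc t) j w \<bullet> noise (Suc t) i w \<partial>M) = 0"
  by (rule noise_orthogonal[OF noise_alg noise_l2]) (use assms in \<open>auto simp: others_def\<close>)

text \<open>Expand the square of \<open>mean_step\<close> minus the averaged noise. All mixed terms have mean zero, so only
  the \<open>n\<close> variances survive and the noise contributes \<open>\<eta>\<^sup>2 \<sigma>\<^sup>2 / n\<close>; \<open>perturbed_step\<close> bounds the rest.\<close>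

lemma distance_sq_Suc_le:
  "distance_sq (Suc t) + \<eta> * gap t
    \<le> distance_sq t + 3 * \<eta> * L / (2 * real CARD('n)) * deviation_bound\<^sup>2 + \<eta>\<^sup>2 * \<sigma>\<^sup>2 / real CARD('n)"
proof -
  let ?n = "real CARD('n)"
  let ?a = "mean_step t" and ?z = "noise (Suc t)"
  obtain b where b: "l2_bounded M ?a b" using mean_step_l2 by blast
  have int_a: "integrable M (\<lambda>w. (norm (?a w))\<^sup>2)" by (rule l2_bounded_integrable_norm_sq[OF b])
  have int_az: "integrable M (\<lambda>w. ?a w \<bullet> ?z i w)" for i
    by (rule l2_bounded_integrable_inner[OF b noise_l2])
  have int_zz: "integrable M (\<lambda>w. ?z i w \<bullet> ?z j w)" for i j
    by (rule l2_bounded_integrable_inner[OF noise_l2 noise_l2])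
  have expand: "(norm (xbar (Suc t) w - xstar))\<^sup>2 = (norm (?a w))\<^sup>2
      - 2 * (\<eta> / ?n) * (\<Sum>i\<in>UNIV. ?a w \<bullet> ?z i w)
      + (\<eta> / ?n)\<^sup>2 * (\<Sum>i\<in>UNIV. \<Sum>j\<in>UNIV. ?z i w \<bullet> ?z j w)" if w: "w \<in> space M" for w
  proof -
    define S where "S = (\<Sum>i\<in>UNIV. ?z i w)"
    have "xbar (Suc t) w - xstar = ?a w - (\<eta> / ?n) *\<^sub>R S"
      unfolding S_def noise_def mean_step_def xbar_Suc[OF w]
      by (simp add: sum_subtractf scaleR_diff_right)
    moreover have "(norm (?a w - c *\<^sub>R S))\<^sup>2 = (norm (?a w))\<^sup>2 - 2 * c * (?a w \<bullet> S) + c\<^sup>2 * (S \<bullet> S)" for c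
      unfolding power2_norm_eq_inner
      by (simp add: inner_diff_left inner_diff_right inner_commute power2_eq_square)
    moreover have "?a w \<bullet> S = (\<Sum>i\<in>UNIV. ?a w \<bullet> ?z i w)"
      by (simp add: S_def inner_sum_right)
    moreover have "S \<bullet> S = (\<Sum>i\<in>UNIV. \<Sum>j\<in>UNIV. ?z i w \<bullet> ?z j w)"
      unfolding S_def by (subst inner_sum_left) (simp only: inner_sum_right)
    ultimately show ?thesis by simp
  qed
  have "distance_sq (Suc t) = (\<integral>w. (norm (?a w))\<^sup>2 - 2 * (\<eta> / ?n) * (\<Sum>i\<in>UNIV. ?a w \<bullet> ?z i w)
      + (\<eta> / ?n)\<^sup>2 * (\<Sum>i\<in>UNIV. \<Sum>j\<in>UNIV. ?z i w \<bullet> ?z j w) \<partial>M)"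
    unfolding distance_sq_def by (rule Bochner_Integration.integral_cong[OF refl expand])
  also have "\<dots> = (\<integral>w. (norm (?a w))\<^sup>2 \<partial>M) - 2 * (\<eta> / ?n) * (\<Sum>i\<in>UNIV. \<integral>w. ?a w \<bullet> ?z i w \<partial>M)
      + (\<eta> / ?n)\<^sup>2 * (\<Sum>i\<in>UNIV. \<Sum>j\<in>UNIV. \<integral>w. ?z i w \<bullet> ?z j w \<partial>M)"
    using int_a int_az int_zz by simp
  also have "(\<Sum>i\<in>UNIV. \<integral>w. ?a w \<bullet> ?z i w \<partial>M) = 0"
    by (intro sum.neutral ballI noise_orthogonal[OF mean_step_others b])
  \<comment> \<open>Noises of different agents are uncorrelated, so only the diagonal remains.\<close>
  also have "(\<Sum>i\<in>UNIV. \<Sum>j\<in>UNIV. \<integral>w. ?z i w \<bullet> ?z j w \<partial>M) = (\<Sum>i\<in>UNIV. \<integral>w. (norm (?z i w))\<^sup>2 \<partial>M)"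
  proof (rule sum.cong[OF refl])
    fix i
    have "(\<Sum>j\<in>UNIV. \<integral>w. ?z i w \<bullet> ?z j w \<partial>M)
        = (\<Sum>j\<in>UNIV. if j = i then \<integral>w. (norm (?z i w))\<^sup>2 \<partial>M else 0)"
      using noise_cross_zero by (intro sum.cong) (auto simp: power2_norm_eq_inner)
    then show "(\<Sum>j\<in>UNIV. \<integral>w. ?z i w \<bullet> ?z j w \<partial>M) = (\<integral>w. (norm (?z i w))\<^sup>2 \<partial>M)" by simp
  qed
  finally have "distance_sq (Suc t)
      = (\<integral>w. (norm (?a w))\<^sup>2 \<partial>M) + (\<eta> / ?n)\<^sup>2 * (\<Sum>i\<in>UNIV. \<integral>w. (norm (?z i w))\<^sup>2 \<partial>M)" by simp
  also have "(\<eta> / ?n)\<^sup>2 * (\<Sum>i\<in>UNIV. \<integral>w. (norm (?z i w))\<^sup>2 \<partial>M)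
      \<le> (\<eta> / ?n)\<^sup>2 * (\<Sum>i\<in>(UNIV::'n set). \<sigma>\<^sup>2)"
    using l2_bounded_integral_norm_sq[OF noise_l2] by (intro mult_left_mono sum_mono) auto
  also have "\<dots> = \<eta>\<^sup>2 * \<sigma>\<^sup>2 / ?n"
    by (simp add: power2_eq_square)
  finally have 1: "distance_sq (Suc t) \<le> (\<integral>w. (norm (?a w))\<^sup>2 \<partial>M) + \<eta>\<^sup>2 * \<sigma>\<^sup>2 / ?n"
    by simp
  let ?dev = "\<lambda>w. (\<chi> i. Z (Suc t) w $ i - xbar t w) :: real^'d^'n"
  have int_x: "integrable M (\<lambda>w. (norm (xbar t w - xstar))\<^sup>2)"
    by (rule l2_bounded_integrable_norm_sq[OF xbar_diff_l2])
  have int_F: "integrable M (\<lambda>w. global_loss D ft (xbar t w))"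
    by (rule integrable_global_loss[OF xbar_l2])
  have int_d: "integrable M (\<lambda>w. (norm (?dev w))\<^sup>2)"
    by (rule l2_bounded_integrable_norm_sq[OF push_sum_ratio_l2])
  let ?c = "3 * \<eta> * L / (2 * ?n)"
  have "(\<integral>w. (norm (?a w))\<^sup>2 \<partial>M) \<le> (\<integral>w. (norm (xbar t w - xstar))\<^sup>2
      - \<eta> * (global_loss D ft (xbar t w) - global_loss D ft xstar) + ?c * (norm (?dev w))\<^sup>2 \<partial>M)"
    by (intro integral_mono int_a mean_step_le Bochner_Integration.integrable_add
        Bochner_Integration.integrable_diff integrable_mult_right int_x int_F int_d integrable_const)
  also have "\<dots> = distance_sq t - \<eta> * gap t + ?c * (\<integral>w. (norm (?dev w))\<^sup>2 \<partial>M)"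
    using int_x int_F int_d prob_space
    by (simp add: distance_sq_def gap_def)
  also have "?c * (\<integral>w. (norm (?dev w))\<^sup>2 \<partial>M) \<le> ?c * deviation_bound\<^sup>2"
    using stepsize L_pos
    by (intro mult_left_mono l2_bounded_integral_norm_sq[OF push_sum_ratio_l2]) auto
  finally show ?thesis using 1 by linarith
qed

text \<open>The squared distances telescope, and the last one is nonnegative.\<close>

lemma average_gap_le:
  assumes "0 < T"
  shows "(1 / real T) * (\<Sum>t<T. gap t) \<le> (norm xstar)\<^sup>2 / (\<eta> * real T) + \<eta> * \<sigma>\<^sup>2 / real CARD('n)
    + 3 * L / (2 * real CARD('n)) * deviation_bound\<^sup>2"
proof -
  let ?n = "real CARD('n)"
  define e where "e = 3 * L / (2 * ?n) * deviation_bound\<^sup>2 + \<eta> * \<sigma>\<^sup>2 / ?n"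
  have step: "distance_sq (Suc t) + \<eta> * gap t \<le> distance_sq t + \<eta> * e" for t
    using distance_sq_Suc_le[of t] by (simp add: e_def distrib_left power2_eq_square mult_ac)
  have "distance_sq T + \<eta> * (\<Sum>t<T. gap t) \<le> distance_sq 0 + real T * (\<eta> * e)"
  proof (induction T)
    case (Suc k)
    then show ?case using step[of k] by (simp add: distrib_left distrib_right)
  qed simp
  moreover have "distance_sq 0 = (norm xstar)\<^sup>2"
  proof -
    have "distance_sq 0 = (\<integral>w. (norm xstar)\<^sup>2 \<partial>M)"
      unfolding distance_sq_def
      by (rule Bochner_Integration.integral_cong) (simp_all add: xbar_def init)
    then show ?thesis using prob_space by simp
  qed
  moreover have "0 \<le> distance_sq T"
    unfolding distance_sq_def by (rule integral_nonneg_AE) simp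
  ultimately have "\<eta> * (\<Sum>t<T. gap t) \<le> (norm xstar)\<^sup>2 + real T * (\<eta> * e)" by linarith
  then have "(\<eta> * (\<Sum>t<T. gap t)) / (\<eta> * real T) \<le> ((norm xstar)\<^sup>2 + real T * (\<eta> * e)) / (\<eta> * real T)"
    using stepsize assms by (intro divide_right_mono) auto
  then have "(1 / real T) * (\<Sum>t<T. gap t) \<le> (norm xstar)\<^sup>2 / (\<eta> * real T) + e"
    using stepsize assms by (simp add: add_divide_distrib)
  then show ?thesis by (simp add: e_def)
qed

lemma average_iterate_bound:
  assumes "0 < T"
  shows "integrable M (\<lambda>w. global_loss D ft
           ((1 / (real CARD('n) * real T)) *\<^sub>R (\<Sum>t<T. \<Sum>i\<in>UNIV. X t w $ i)))" (is "integrable M ?f")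
    and "(\<integral>w. global_loss D ft
           ((1 / (real CARD('n) * real T)) *\<^sub>R (\<Sum>t<T. \<Sum>i\<in>UNIV. X t w $ i)) \<partial>M)
         - global_loss D ft xstar
       \<le> (norm xstar)\<^sup>2 / (\<eta> * real T) + \<eta> * \<sigma>\<^sup>2 / real CARD('n)
         + 3 * L / (2 * real CARD('n)) * deviation_bound\<^sup>2"
proof -
  have avg: "(1 / (real CARD('n) * real T)) *\<^sub>R (\<Sum>t<T. \<Sum>i\<in>UNIV. X t w $ i)
      = (1 / real T) *\<^sub>R (\<Sum>t<T. xbar t w)" for w
    by (simp add: xbar_def scaleR_sum_right[symmetric])
  have "l2_bounded M (\<lambda>w. \<Sum>t<T. xbar t w) (\<Sum>t<T. real t * (\<eta> * \<bar>G\<bar>))"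
    by (intro l2_bounded_sum xbar_l2) simp
  from integrable_global_loss[OF l2_bounded_scaleR[OF this, of "1 / real T"]]
  show int: "integrable M ?f" unfolding avg .
  have int_F: "integrable M (\<lambda>w. global_loss D ft (xbar t w))" for t
    by (rule integrable_global_loss[OF xbar_l2])
  have "(\<integral>w. ?f w \<partial>M) \<le> (\<integral>w. (1 / real T) * (\<Sum>t<T. global_loss D ft (xbar t w)) \<partial>M)"
    unfolding avg
    by (intro integral_mono int[unfolded avg] loss.F_average_le assms integrable_mult_right
        Bochner_Integration.integrable_sum int_F)
  also have "\<dots> = (1 / real T) * (\<Sum>t<T. \<integral>w. global_loss D ft (xbar t w) \<partial>M)"
    using int_F by simp
  also have "\<dots> = (1 / real T) * (\<Sum>t<T. gap t) + global_loss D ft xstar"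
    using assms by (simp add: gap_def sum_subtractf diff_divide_distrib)
  finally show "(\<integral>w. ?f w \<partial>M) - global_loss D ft xstar
       \<le> (norm xstar)\<^sup>2 / (\<eta> * real T) + \<eta> * \<sigma>\<^sup>2 / real CARD('n)
         + 3 * L / (2 * real CARD('n)) * deviation_bound\<^sup>2"
    using average_gap_le[OF assms] by linarith
qed

end

text \<open>The stepsize balances the first two terms at order \<open>1 / sqrt (n T)\<close> and makes the squared deviation,
  which is quadratic in \<open>\<eta>\<close>, of order \<open>1 / T\<close>. Its constant comes out as
  \<open>3 / 2 * 27\<^sup>2 / 16 = 2187 / 32\<close>, which is less than 153.\<close>

lemma tuned_stepsize_bound:
  fixes L n T dev K a s g q k \<eta> :: real
  assumes pos: "0 < L" "0 < n" "0 < T" "0 < q" "0 < k"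
    and \<eta>: "\<eta> = sqrt n / (4 * L * sqrt T)"
    and dev: "0 \<le> dev" "dev \<le> 27 * K * (\<eta> * (\<bar>g\<bar> * sqrt n)) / (q * k)"
  shows "a\<^sup>2 / (\<eta> * T) + \<eta> * s\<^sup>2 / n + 3 * L / (2 * n) * dev\<^sup>2
    \<le> (16 * L\<^sup>2 * a\<^sup>2 + s\<^sup>2) / (4 * L) / sqrt (n * T) + 153 * K\<^sup>2 * g\<^sup>2 * n / (L * q\<^sup>2 * k\<^sup>2) / T"
proof -
  obtain u where u: "0 < u" "n = u\<^sup>2" using pos by (metis real_sqrt_gt_zero real_sqrt_pow2 less_imp_le)
  obtain v where v: "0 < v" "T = v\<^sup>2" using pos by (metis real_sqrt_gt_zero real_sqrt_pow2 less_imp_le)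
  have s: "sqrt n = u" "sqrt T = v" "sqrt (n * T) = u * v"
    using u v by (simp_all add: real_sqrt_mult)
  have e: "\<eta> = u / (4 * L * v)" using \<eta> s by simp
  have "a\<^sup>2 / (\<eta> * T) + \<eta> * s\<^sup>2 / n = (16 * L\<^sup>2 * a\<^sup>2 + s\<^sup>2) / (4 * L) / (u * v)"
    using u v pos by (simp add: e field_simps power2_eq_square)
  moreover have "3 * L / (2 * n) * dev\<^sup>2 \<le> 153 * K\<^sup>2 * g\<^sup>2 * n / (L * q\<^sup>2 * k\<^sup>2) / T"
  proof -
    have "dev\<^sup>2 \<le> (27 * K * (\<eta> * (\<bar>g\<bar> * u)) / (q * k))\<^sup>2"
      using dev unfolding s by (intro power_mono) auto
    also have "\<dots> = 729 * K\<^sup>2 * (\<eta>\<^sup>2 * (g\<^sup>2 * u\<^sup>2)) / (q\<^sup>2 * k\<^sup>2)"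
      by (simp add: power_mult_distrib power_divide)
    finally have "3 * L / (2 * n) * dev\<^sup>2 \<le> 3 * L / (2 * n) * (729 * K\<^sup>2 * (\<eta>\<^sup>2 * (g\<^sup>2 * u\<^sup>2)) / (q\<^sup>2 * k\<^sup>2))"
      using pos by (intro mult_left_mono) auto
    also have "\<dots> = 2187 / 32 * (K\<^sup>2 * g\<^sup>2 * n / (L * q\<^sup>2 * k\<^sup>2) / T)"
      using u v pos by (simp add: e field_simps power2_eq_square)
    also have "\<dots> \<le> 153 * (K\<^sup>2 * g\<^sup>2 * n / (L * q\<^sup>2 * k\<^sup>2) / T)"
      using pos by (intro mult_right_mono) auto
    finally show ?thesis by simp
  qed
  ultimately show ?thesis unfolding s by linarith
qed

theorem theorem3:
  fixes E :: "('n::finite \<times> 'n) set"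
    and W :: "real^'n^'n"
    and \<phi> :: "real^'n"
    and \<delta> C \<kappa> \<beta> \<omega> \<sigma> G L \<gamma> \<eta> C4 C5 :: real
    and T :: nat
    and D :: "'n \<Rightarrow> 's measure"
    and ft :: "'n \<Rightarrow> real^'d::finite \<Rightarrow> 's \<Rightarrow> real"
    and R :: "'q measure"
    and Q :: "real^'d \<Rightarrow> 'q \<Rightarrow> real^'d"
    and M :: "'w measure"
    and \<xi> :: "'n \<Rightarrow> nat \<Rightarrow> 'w \<Rightarrow> 's"
    and \<rho> :: "'n \<Rightarrow> nat \<Rightarrow> 'w \<Rightarrow> 'q"
    and X Xh U Z :: "nat \<Rightarrow> 'w \<Rightarrow> real^'d^'n"
    and y :: "nat \<Rightarrow> real^'n"
    and xstar :: "real^'d"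
  assumes graph: "strongly_connected E"
    and mixing: "mixing_matrix E W"
    and beta: "\<beta> = spectral_norm (W - mat 1)"
    and delta: "0 < \<delta>" "\<delta> \<le> 1"
    and C_pos: "0 < C"
    and kappa_pos: "0 < \<kappa>"
    and phi: "stochastic_vector \<phi>"
    and phi_fixed: "W *v \<phi> = \<phi>"
    and kappa: "\<And>t i. \<kappa> \<le> (matrix_pow W t *v vec 1) $ i"
    and ergodic: "\<And>t. spectral_norm (matrix_pow W t - outer_prod \<phi> (vec 1)) \<le> C * (1 - \<delta>) ^ t"
    and omega: "0 < \<omega>" "\<omega> \<le> 1"
    and compression: "compression_operator \<omega> R Q"
    and problem: "stochastic_problem D ft"
    and bounded_variance: "\<And>i x.
      (\<integral>\<^sup>+s. ennreal ((norm (stoch_grad ft i x s - gradient (local_loss D ft i) x))\<^sup>2) \<partial>D i)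
        \<le> ennreal (\<sigma>\<^sup>2)"
    and bounded_gradients: "\<And>i x.
      (\<integral>\<^sup>+s. ennreal ((norm (stoch_grad ft i x s))\<^sup>2) \<partial>D i) \<le> ennreal (G\<^sup>2)"
    and L_pos: "0 < L"
    and smooth: "\<And>i u v.
      norm (gradient (local_loss D ft i) u - gradient (local_loss D ft i) v) \<le> L * norm (u - v)"
    and convex: "\<And>i u v.
      local_loss D ft i u + gradient (local_loss D ft i) u \<bullet> (v - u) \<le> local_loss D ft i v"
    and minimizer: "is_arg_min (global_loss D ft) (\<lambda>_. True) xstar"
    and T_ge: "T \<ge> CARD('n)"
    and eta: "\<eta> = sqrt (real CARD('n)) / (4 * L * sqrt (real T))"
    and gamma: "\<gamma> = \<omega> * \<delta> / (12 * \<beta> * (\<beta> + 1) * (C + 1))"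
    and gamma_range: "0 < \<gamma>" "\<gamma> \<le> 1"
    and randomness: "algorithm_randomness M D R \<xi> \<rho>"
    and iteration: "compressed_push_sum_sgd W ft Q \<gamma> \<eta> M \<xi> \<rho> X Xh U Z y"
    and init: "\<And>w. w \<in> space M \<Longrightarrow> X 0 w = 0" "\<And>w. w \<in> space M \<Longrightarrow> Xh 0 w = 0" "y 0 = vec 1"
    and C4: "C4 = (16 * L\<^sup>2 * (norm xstar)\<^sup>2 + \<sigma>\<^sup>2) / (4 * L)"
    and C5: "C5 = 153 * C\<^sup>2 * (C + 1)\<^sup>2 * \<beta>\<^sup>2 * (\<beta> + 1)\<^sup>2 * G\<^sup>2 * real CARD('n) /
      (L * \<omega>\<^sup>2 * \<delta> ^ 4 * \<kappa>\<^sup>2)"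
  shows "integrable M (\<lambda>w. global_loss D ft
           ((1 / (real CARD('n) * real T)) *\<^sub>R (\<Sum>t<T. \<Sum>i\<in>UNIV. X t w $ i)))
       \<and> (\<integral>w. global_loss D ft
           ((1 / (real CARD('n) * real T)) *\<^sub>R (\<Sum>t<T. \<Sum>i\<in>UNIV. X t w $ i)) \<partial>M)
         - global_loss D ft xstar
       \<le> C4 / sqrt (real CARD('n) * real T) + C5 / real T"
proof -
  have n: "0 < real CARD('n)" "0 < real T" "real CARD('n) \<le> real T"
    using T_ge zero_less_card_finite[where 'a='n] by linarith+
  have eta_pos: "0 < \<eta>" using n L_pos by (simp add: eta)
  \<comment> \<open>With \<open>T \<ge> n\<close> the stepsize is in the range where a perturbed gradient step makes progress.\<close>
  have eta_le: "4 * L * \<eta> \<le> 1"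
    using n L_pos by (simp add: eta)
  interpret push_sum_sgd W \<phi> \<delta> C \<kappa> \<beta> \<omega> \<sigma> G L \<gamma> \<eta> D ft R Q M \<xi> \<rho> X Xh U Z y xstar
  proof
    show "vec 1 v* W = vec 1" using mixing by (simp only: mixing_matrix_def)
  qed (fact assms eta_pos eta_le)+
  let ?K = "C * (C + 1) * \<beta> * (\<beta> + 1)"
  have "(norm xstar)\<^sup>2 / (\<eta> * real T) + \<eta> * \<sigma>\<^sup>2 / real CARD('n)
      + 3 * L / (2 * real CARD('n)) * deviation_bound\<^sup>2
    \<le> (16 * L\<^sup>2 * (norm xstar)\<^sup>2 + \<sigma>\<^sup>2) / (4 * L) / sqrt (real CARD('n) * real T)
      + 153 * ?K\<^sup>2 * G\<^sup>2 * real CARD('n) / (L * (\<omega> * \<delta>\<^sup>2)\<^sup>2 * \<kappa>\<^sup>2) / real T"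
  proof (rule tuned_stepsize_bound[OF L_pos n(1,2) _ kappa_pos eta deviation_bound_nonneg])
    show "0 < \<omega> * \<delta>\<^sup>2" using omega delta by simp
    show "deviation_bound \<le> 27 * ?K * (\<eta> * (\<bar>G\<bar> * sqrt (real CARD('n)))) / (\<omega> * \<delta>\<^sup>2 * \<kappa>)"
      using deviation_bound_le by (simp only: noise_level_def mult.assoc)
  qed
  also have "\<dots> = C4 / sqrt (real CARD('n) * real T) + C5 / real T"
    by (simp add: C4 C5 power_mult_distrib)
  finally show ?thesis
    using average_iterate_bound[of T] n(2) by auto
qed

end
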